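(* Let $X$ be a bipartite Coxeter graph whose Coxeter group $W=W(X)$ is star reducible. Let $w\in W$ be fully commutative and let $E$ be the heap of $w$. Then every boundary vertex of $E$ is linearly equivalent to an effective boundary vertex of $E$.
   Context: A Coxeter system $(W,S)$ has presentation $\langle S\mid (st)^{m(s,t)}=1\rangle$ with $m(s,s)=1$; its Coxeter graph $X$ has vertex set $S$, with $s,t$ joined by an edge (labelled $m(s,t)$) iff $m(s,t)\ge 3$. Length $\ell$ is the usual length function. An element $w\in W$ is fully commutative if any two reduced expressions of $w$ are related by repeatedly swapping adjacent commuting generators; $W_c$ denotes the set of such elements. Star operations: for noncommuting $s,t\in S$ and $I=\{s,t\}$, every $w\in W$ factors uniquely as $w=w_Iw^I$ with $w_I\in\langle s,t\rangle$, $w^I$ having no left descent in $I$, and $\ell(w)=\ell(w_I)+\ell(w^I)$. The left $\{s,t\}$-strings are the sequences $sw^I, tsw^I, stsw^I,\dots$ and $tw^I, stw^I, tstw^I,\dots$ (each of $m(s,t)-1$ elements). If $x,y$ lie in a common string with $\ell(x)=\ell(y)-1$, $y$ is left star reducible to $x$; right star reducibility is defined symmetrically using right cosets. $y$ is star reducible to $x$ if there is a sequence $x=w_0,\dots,w_k=y$ with each $w_{i+1}$ left or right star reducible to $w_i$. $W$ is star reducible if every element of $W_c$ is star reducible to a product of pairwise commuting generators. Heap: for a word $s_{i_1}\cdots s_{i_l}$ in $S$, its heap is the set $E=\{1,\dots,l\}$ with labels $\varepsilon(j)=s_{i_j}$ and partial order the reflexive transitive closure of the relation "$a\le b$ as integers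 and $\varepsilon(a),\varepsilon(b)$ are equal or adjacent in $X$", taken up to label-preserving poset isomorphism. All reduced expressions of $w\in W_c$ give the same heap, the heap of $w$. Boundary map: fix a field $k$. Vertices are the elements of $E$; $C_0$ is their $k$-span. Edges are pairs $(x,y)$ with $x<y$, $\varepsilon(x)=\varepsilon(y)$, and no $z$ with $x<z<y$ and $\varepsilon(z)=\varepsilon(x)$; $C_1$ is their $k$-span. The linear map $\partial_E:C_1\to C_0$ sends $(x,y)$ to $\sum z$ over $z$ with $x<z<y$ and $\varepsilon(z)$ equal or adjacent to $\varepsilon(x)$. A vertex $v$ is a boundary vertex if $v\in\operatorname{Im}\partial_E$, and an effective boundary vertex if $\partial_E(e)=v$ for some edge $e$. Write $v_1 R v_2$ if $\partial_E(e)=v_1+v_2$ for some edge $e$; linear equivalence is the reflexive transitive closure of $R$. *)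

theory Defs
  imports
    "HOL-Algebra.Generated_Groups"
    "HOL-Library.Extended_Nat"
    "HOL-Library.Poly_Mapping"
begin

section \<open>Groups given by generators and relators\<close>

text \<open>
  A signed letter \<^term>\<open>(s, True)\<close> stands for the generator \<open>s\<close> and
  \<^term>\<open>(s, False)\<close> for its formal inverse.
\<close>

inductive pres_step ::
  "'s set \<Rightarrow> ('s \<times> bool) list set \<Rightarrow> ('s \<times> bool) list \<Rightarrow> ('s \<times> bool) list \<Rightarrow> bool"
  for S R where
  cancel: "s \<in> S \<Longrightarrow> pres_step S R (u @ [(s, b), (s, \<not> b)] @ v) (u @ v)"
| relator: "r \<in> R \<Longrightarrow> pres_step S R (u @ r @ v) (u @ v)"

definition word_prod :: "('a, 'b) monoid_scheme \<Rightarrow> 'a list \<Rightarrow> 'a" where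
  "word_prod G ws = foldr (\<otimes>\<^bsub>G\<^esub>) ws \<one>\<^bsub>G\<^esub>"

definition signed_val :: "('a, 'b) monoid_scheme \<Rightarrow> ('a \<times> bool) list \<Rightarrow> 'a" where
  "signed_val G u = word_prod G (map (\<lambda>(s, b). if b then s else inv\<^bsub>G\<^esub> s) u)"

definition has_presentation ::
  "('a, 'b) monoid_scheme \<Rightarrow> 'a set \<Rightarrow> ('a \<times> bool) list set \<Rightarrow> bool" where
  "has_presentation G S R \<longleftrightarrow>
     S \<subseteq> carrier G \<and> generate G S = carrier G \<and>
     (\<forall>u \<in> lists (S \<times> UNIV). \<forall>v \<in> lists (S \<times> UNIV).
        signed_val G u = signed_val G v \<longleftrightarrow> equivclp (pres_step S R) u v)"


section \<open>Coxeter systems\<close>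

definition coxeter_matrix :: "'s set \<Rightarrow> ('s \<Rightarrow> 's \<Rightarrow> enat) \<Rightarrow> bool" where
  "coxeter_matrix S m \<longleftrightarrow>
     (\<forall>s\<in>S. m s s = 1) \<and>
     (\<forall>s\<in>S. \<forall>t\<in>S. m s t = m t s \<and> (s \<noteq> t \<longrightarrow> 2 \<le> m s t))"

text \<open>There is no relator for a pair with \<^term>\<open>m s t = \<infinity>\<close>.\<close>

definition coxeter_relators :: "'s set \<Rightarrow> ('s \<Rightarrow> 's \<Rightarrow> enat) \<Rightarrow> ('s \<times> bool) list set" where
  "coxeter_relators S m =
     {concat (replicate n [(s, True), (t, True)]) | s t n. s \<in> S \<and> t \<in> S \<and> m s t = enat n}"

locale coxeter_system = group G for G (structure) +
  fixes S :: "'a set" and m :: "'a \<Rightarrow> 'a \<Rightarrow> enat"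
  assumes coxeter_matrix: "coxeter_matrix S m"
    and presentation: "has_presentation G S (coxeter_relators S m)"

definition coxeter_adj :: "'s set \<Rightarrow> ('s \<Rightarrow> 's \<Rightarrow> enat) \<Rightarrow> 's \<Rightarrow> 's \<Rightarrow> bool" where
  "coxeter_adj S m s t \<longleftrightarrow> s \<in> S \<and> t \<in> S \<and> s \<noteq> t \<and> 3 \<le> m s t"

definition bipartite_graph :: "'s set \<Rightarrow> ('s \<Rightarrow> 's \<Rightarrow> bool) \<Rightarrow> bool" where
  "bipartite_graph V adj \<longleftrightarrow>
     (\<exists>A B. A \<union> B = V \<and> A \<inter> B = {} \<and>
        (\<forall>s\<in>A. \<forall>t\<in>A. \<not> adj s t) \<and> (\<forall>s\<in>B. \<forall>t\<in>B. \<not> adj s t))"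

text \<open>The alternating word \<open>s, t, s, \<dots>\<close> with the given number of letters.\<close>

fun alt :: "'s \<Rightarrow> 's \<Rightarrow> nat \<Rightarrow> 's list" where
  "alt s t 0 = []"
| "alt s t (Suc n) = s # alt t s n"

context coxeter_system
begin

definition ell :: "'a \<Rightarrow> nat" where
  "ell w = (LEAST n. \<exists>ws \<in> lists S. length ws = n \<and> word_prod G ws = w)"

definition reduced_expr :: "'a \<Rightarrow> 'a list \<Rightarrow> bool" where
  "reduced_expr w ws \<longleftrightarrow> ws \<in> lists S \<and> word_prod G ws = w \<and> length ws = ell w"

inductive comm_swap :: "'a list \<Rightarrow> 'a list \<Rightarrow> bool" where
  "s \<in> S \<Longrightarrow> t \<in> S \<Longrightarrow> s \<otimes> t = t \<otimes> s \<Longrightarrow> comm_swap (u @ [s, t] @ v) (u @ [t, s] @ v)"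

definition fully_commutative :: "'a \<Rightarrow> bool" where
  "fully_commutative w \<longleftrightarrow>
     w \<in> carrier G \<and>
     (\<forall>u v. reduced_expr w u \<longrightarrow> reduced_expr w v \<longrightarrow> comm_swap\<^sup>*\<^sup>* u v)"

definition left_descent :: "'a \<Rightarrow> 'a \<Rightarrow> bool" where
  "left_descent w s \<longleftrightarrow> s \<in> S \<and> ell (s \<otimes> w) < ell w"

definition right_descent :: "'a \<Rightarrow> 'a \<Rightarrow> bool" where
  "right_descent w s \<longleftrightarrow> s \<in> S \<and> ell (w \<otimes> s) < ell w"

text \<open>
  For \<open>v\<close> without left descents in \<open>{s, t}\<close>, \<open>left_string s t v\<close> is the string
  \<open>s v, t s v, s t s v, \<dots>\<close> with \<open>m s t - 1\<close> elements; the second string of the coset is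
  \<open>left_string t s v\<close>.
\<close>

definition left_string :: "'a \<Rightarrow> 'a \<Rightarrow> 'a \<Rightarrow> 'a set" where
  "left_string s t v = {word_prod G (rev (alt s t n)) \<otimes> v | n. 1 \<le> n \<and> enat n < m s t}"

definition right_string :: "'a \<Rightarrow> 'a \<Rightarrow> 'a \<Rightarrow> 'a set" where
  "right_string s t v = {v \<otimes> word_prod G (alt s t n) | n. 1 \<le> n \<and> enat n < m s t}"

definition left_star_reducible :: "'a \<Rightarrow> 'a \<Rightarrow> bool" where
  "left_star_reducible y x \<longleftrightarrow>
     (\<exists>s\<in>S. \<exists>t\<in>S. \<exists>v\<in>carrier G.
        s \<otimes> t \<noteq> t \<otimes> s \<and> \<not> left_descent v s \<and> \<not> left_descent v t \<and>
        x \<in> left_string s t v \<and> y \<in> left_string s t v \<and> ell y = Suc (ell x))"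

definition right_star_reducible :: "'a \<Rightarrow> 'a \<Rightarrow> bool" where
  "right_star_reducible y x \<longleftrightarrow>
     (\<exists>s\<in>S. \<exists>t\<in>S. \<exists>v\<in>carrier G.
        s \<otimes> t \<noteq> t \<otimes> s \<and> \<not> right_descent v s \<and> \<not> right_descent v t \<and>
        x \<in> right_string s t v \<and> y \<in> right_string s t v \<and> ell y = Suc (ell x))"

definition star_reducible_to :: "'a \<Rightarrow> 'a \<Rightarrow> bool" where
  "star_reducible_to = (\<lambda>y x. left_star_reducible y x \<or> right_star_reducible y x)\<^sup>*\<^sup>*"

definition commuting_product :: "'a \<Rightarrow> bool" where
  "commuting_product x \<longleftrightarrow>
     (\<exists>ws \<in> lists S. x = word_prod G ws \<and>
        (\<forall>s \<in> set ws. \<forall>t \<in> set ws. s \<otimes> t = t \<otimes> s))"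

definition star_reducible :: bool where
  "star_reducible \<longleftrightarrow>
     (\<forall>w. fully_commutative w \<longrightarrow> (\<exists>x. commuting_product x \<and> star_reducible_to w x))"

end


section \<open>Heaps\<close>

record ('e, 's) labelled_poset =
  elts :: "'e set"
  leq :: "'e \<Rightarrow> 'e \<Rightarrow> bool"
  lab :: "'e \<Rightarrow> 's"

definition labelled_poset_iso ::
  "('e, 's) labelled_poset \<Rightarrow> ('f, 's) labelled_poset \<Rightarrow> bool" where
  "labelled_poset_iso E F \<longleftrightarrow>
     (\<exists>f. bij_betw f (elts E) (elts F) \<and>
        (\<forall>x \<in> elts E. lab F (f x) = lab E x) \<and>
        (\<forall>x \<in> elts E. \<forall>y \<in> elts E. leq E x y \<longleftrightarrow> leq F (f x) (f y)))"

text \<open>Positions in a word are numbered from 0.\<close>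

definition word_heap :: "('s \<Rightarrow> 's \<Rightarrow> bool) \<Rightarrow> 's list \<Rightarrow> (nat, 's) labelled_poset" where
  "word_heap adj ws =
     \<lparr>elts = {..<length ws},
      leq = (\<lambda>a b. a < length ws \<and> b < length ws \<and> a \<le> b \<and>
              (ws ! a = ws ! b \<or> adj (ws ! a) (ws ! b)))\<^sup>*\<^sup>*,
      lab = (\<lambda>a. ws ! a)\<rparr>"

text \<open>
  A heap is only defined up to isomorphism, so being the heap of an element is a predicate
  on labelled posets.
\<close>

definition (in coxeter_system) heap_of :: "'a \<Rightarrow> ('e, 'a) labelled_poset \<Rightarrow> bool" where
  "heap_of w E \<longleftrightarrow>
     (\<exists>ws. reduced_expr w ws \<and> labelled_poset_iso (word_heap (coxeter_adj S m) ws) E)"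


section \<open>The boundary map of a heap\<close>

text \<open>
  The spans of the vertices and of the edges over the field \<^typ>\<open>'k\<close> are spaces of finitely
  supported functions; \<^term>\<open>Poly_Mapping.single x 1\<close> is the basis vector at \<open>x\<close>.
\<close>

definition lt :: "('e, 's) labelled_poset \<Rightarrow> 'e \<Rightarrow> 'e \<Rightarrow> bool" where
  "lt E x y \<longleftrightarrow> leq E x y \<and> x \<noteq> y"

definition edges :: "('e, 's) labelled_poset \<Rightarrow> ('e \<times> 'e) set" where
  "edges E = {(x, y). x \<in> elts E \<and> y \<in> elts E \<and> lt E x y \<and> lab E x = lab E y \<and>
     \<not> (\<exists>z \<in> elts E. lt E x z \<and> lt E z y \<and> lab E z = lab E x)}"

definition C1 :: "('e, 's) labelled_poset \<Rightarrow> (('e \<times> 'e) \<Rightarrow>\<^sub>0 'k::field) set" where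
  "C1 E = {c. Poly_Mapping.keys c \<subseteq> edges E}"

definition boundary_edge ::
  "('s \<Rightarrow> 's \<Rightarrow> bool) \<Rightarrow> ('e, 's) labelled_poset \<Rightarrow> 'e \<times> 'e \<Rightarrow> ('e \<Rightarrow>\<^sub>0 'k::field)" where
  "boundary_edge adj E = (\<lambda>(x, y).
     \<Sum>z \<in> {z \<in> elts E. lt E x z \<and> lt E z y \<and> (lab E z = lab E x \<or> adj (lab E z) (lab E x))}.
       Poly_Mapping.single z 1)"

definition boundary_map ::
  "('s \<Rightarrow> 's \<Rightarrow> bool) \<Rightarrow> ('e, 's) labelled_poset \<Rightarrow> (('e \<times> 'e) \<Rightarrow>\<^sub>0 'k::field) \<Rightarrow> ('e \<Rightarrow>\<^sub>0 'k)"
where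
  "boundary_map adj E c =
     (\<Sum>e \<in> Poly_Mapping.keys c.
        Poly_Mapping.map (\<lambda>a. Poly_Mapping.lookup c e * a) (boundary_edge adj E e))"

text \<open>
  The field enters the following notions only through its type, which is passed as an
  argument of type \<^typ>\<open>'k itself\<close>.
\<close>

definition boundary_vertex ::
  "'k::field itself \<Rightarrow> ('s \<Rightarrow> 's \<Rightarrow> bool) \<Rightarrow> ('e, 's) labelled_poset \<Rightarrow> 'e \<Rightarrow> bool" where
  "boundary_vertex K adj E v \<longleftrightarrow>
     v \<in> elts E \<and> (Poly_Mapping.single v 1 :: 'e \<Rightarrow>\<^sub>0 'k) \<in> boundary_map adj E ` C1 E"

definition effective_boundary_vertex ::
  "'k::field itself \<Rightarrow> ('s \<Rightarrow> 's \<Rightarrow> bool) \<Rightarrow> ('e, 's) labelled_poset \<Rightarrow> 'e \<Rightarrow> bool" where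
  "effective_boundary_vertex K adj E v \<longleftrightarrow>
     v \<in> elts E \<and>
     (\<exists>e \<in> edges E. boundary_map adj E (Poly_Mapping.single e 1) =
        (Poly_Mapping.single v 1 :: 'e \<Rightarrow>\<^sub>0 'k))"

definition linear_relation ::
  "'k::field itself \<Rightarrow> ('s \<Rightarrow> 's \<Rightarrow> bool) \<Rightarrow> ('e, 's) labelled_poset \<Rightarrow> 'e \<Rightarrow> 'e \<Rightarrow> bool" where
  "linear_relation K adj E v1 v2 \<longleftrightarrow>
     v1 \<in> elts E \<and> v2 \<in> elts E \<and>
     (\<exists>e \<in> edges E. boundary_map adj E (Poly_Mapping.single e 1) =
        (Poly_Mapping.single v1 1 + Poly_Mapping.single v2 1 :: 'e \<Rightarrow>\<^sub>0 'k))"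

definition linearly_equivalent ::
  "'k::field itself \<Rightarrow> ('s \<Rightarrow> 's \<Rightarrow> bool) \<Rightarrow> ('e, 's) labelled_poset \<Rightarrow> 'e \<Rightarrow> 'e \<Rightarrow> bool" where
  "linearly_equivalent K adj E = (linear_relation K adj E)\<^sup>*\<^sup>*"

end

theory Submission
  imports Defs Complex_Main "HOL-Combinatorics.Transposition" "HOL-Library.Multiset"
begin

text \<open>
  The argument goes by induction along star reductions. Write a reduced word of \<open>w\<close> as
  \<open>s t u\<close> with \<open>s\<close>, \<open>t\<close> adjacent, reducing to \<open>t u\<close> (right reductions are
  reversals of left ones). The only edge whose boundary contains the vertex of \<open>t\<close> is the
  edge \<open>e\<close> starting at the first letter. Reading off the coefficient of \<open>t\<close> shows
  inductively that \<open>\<partial>\<close> is injective for every fully commutative element. It also shows that a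
  boundary vertex of \<open>s t u\<close> is either a boundary vertex of \<open>t u\<close>, or the vertex \<open>t\<close>
  itself. In the latter case let \<open>\<partial> e = t + Z\<close>. If \<open>Z\<close> is empty then \<open>t\<close> is effective, and
  if \<open>Z\<close> is a single vertex then it is a boundary vertex of \<open>t u\<close> and induction applies.
  If \<open>Z\<close> has at least two vertices then \<open>s u\<close> is still a reduced word of a fully commutative
  element; since the graph is bipartite the chain with boundary \<open>t\<close> can be supported on edges in the
  colour class of \<open>s\<close>, and it becomes a nonzero cycle of \<open>s u\<close>, a contradiction.
\<close>

section \<open>Incidence structures\<close>

text \<open>The word \<open>s u\<close> in the last case need not occur in the chosen star reduction
  of \<open>s t u\<close>, so the induction that produces effective vertices says nothing about it.
  This is why injectivity of the boundary map needs its own induction, valid for every fully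
  commutative element. That \<open>s u\<close> is fully commutative comes from counting: the
  vertices of \<open>Z\<close> are letters between the first two occurrences of \<open>s\<close>
  that do not commute with \<open>s\<close>, and with two of them present neither a square nor a
  braid of length at least 3 can start at the first \<open>s\<close>. The passage from group
  elements to words rests on Matsumoto's theorem, hence on the exchange condition and on
  \<open>s t\<close> having order exactly \<open>m s t\<close>. The relators bound this order only
  from above; the lower bound comes from a representation.\<close>

definition bsum :: "'e set \<Rightarrow> ('e \<Rightarrow> 'v set) \<Rightarrow> ('e \<Rightarrow> 'k::field) \<Rightarrow> 'v \<Rightarrow> 'k" where
  "bsum Ed B c x = (\<Sum>e\<in>Ed. if x \<in> B e then c e else 0)"

definition inc_acyclic :: "'k::field itself \<Rightarrow> 'e set \<Rightarrow> ('e \<Rightarrow> 'v set) \<Rightarrow> bool" where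
  "inc_acyclic K Ed B \<longleftrightarrow> (\<forall>c::'e \<Rightarrow> 'k. (\<forall>x. bsum Ed B c x = 0) \<longrightarrow> (\<forall>e\<in>Ed. c e = 0))"

text \<open>With \<open>x = y\<close> the set \<open>{x, y}\<close> would be a singleton and
  describe the boundary \<open>x\<close>, not \<open>x + y\<close>.\<close>

definition inc_rel :: "'e set \<Rightarrow> ('e \<Rightarrow> 'v set) \<Rightarrow> 'v \<Rightarrow> 'v \<Rightarrow> bool" where
  "inc_rel Ed B x y \<longleftrightarrow> x \<noteq> y \<and> (\<exists>e\<in>Ed. B e = {x, y})"

definition inc_boundary :: "'k::field itself \<Rightarrow> 'e set \<Rightarrow> ('e \<Rightarrow> 'v set) \<Rightarrow> 'v \<Rightarrow> bool" where
  "inc_boundary K Ed B v \<longleftrightarrow> (\<exists>c::'e \<Rightarrow> 'k. \<forall>x. bsum Ed B c x = of_bool (x = v))"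

definition inc_effective :: "'k::field itself \<Rightarrow> 'e set \<Rightarrow> ('e \<Rightarrow> 'v set) \<Rightarrow> bool" where
  "inc_effective K Ed B \<longleftrightarrow>
     (\<forall>v. inc_boundary K Ed B v \<longrightarrow> (\<exists>u. (\<exists>e\<in>Ed. B e = {u}) \<and> (inc_rel Ed B)\<^sup>*\<^sup>* v u))"

lemma bsum_eq_0: "(\<And>e. e \<in> Ed \<Longrightarrow> x \<notin> B e) \<Longrightarrow> bsum Ed B c x = 0"
  by (simp add: bsum_def)

lemma bsum_reindex:
  assumes "bij_betw g Ed Ed'" "\<And>e. e \<in> Ed \<Longrightarrow> x \<in> B e \<longleftrightarrow> x' \<in> B' (g e)"
  shows "bsum Ed B (\<lambda>e. c (g e)) x = bsum Ed' B' c x'"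
proof -
  have "bsum Ed' B' c x' = (\<Sum>e\<in>Ed. if x' \<in> B' (g e) then c (g e) else 0)"
    unfolding bsum_def using sum.reindex_bij_betw[OF assms(1), of "\<lambda>e. if x' \<in> B' e then c e else 0"] by simp
  then show ?thesis unfolding bsum_def using assms(2) by (auto intro: sum.cong)
qed

lemma inc_rel_image:
  assumes "\<And>e. e \<in> Ed \<Longrightarrow> B e \<subseteq> V" "inj_on f V"
    and "\<And>e. e \<in> Ed \<Longrightarrow> g e \<in> Ed'" "\<And>e. e \<in> Ed \<Longrightarrow> B' (g e) = f ` B e"
    and "inc_rel Ed B x y"
  shows "inc_rel Ed' B' (f x) (f y)"
proof -
  obtain e where e: "x \<noteq> y" "e \<in> Ed" "B e = {x, y}" using assms(5) by (auto simp: inc_rel_def)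
  then have "x \<in> V" "y \<in> V" using assms(1) by auto
  then have "f x \<noteq> f y" using e(1) assms(2) by (auto dest: inj_onD)
  moreover have "B' (g e) = {f x, f y}" using assms(4)[OF e(2)] e(3) by simp
  ultimately show ?thesis unfolding inc_rel_def using assms(3)[OF e(2)] by blast
qed

lemma inc_rel_rtranclp_image:
  assumes "\<And>e. e \<in> Ed \<Longrightarrow> B e \<subseteq> V" "inj_on f V"
    and "\<And>e. e \<in> Ed \<Longrightarrow> g e \<in> Ed'" "\<And>e. e \<in> Ed \<Longrightarrow> B' (g e) = f ` B e"
    and "(inc_rel Ed B)\<^sup>*\<^sup>* x y"
  shows "(inc_rel Ed' B')\<^sup>*\<^sup>* (f x) (f y)"
  using assms(5)
proof (induction rule: rtranclp_induct)
  case base then show ?case by simp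
next
  case (step y z)
  have "inc_rel Ed' B' (f y) (f z)"
    by (rule inc_rel_image[of Ed B V f g Ed' B']) (use assms step in auto)
  with step.IH show ?case by (rule rtranclp.rtrancl_into_rtrancl)
qed

text \<open>\<open>V\<close> contains all boundaries, so coefficients outside it vanish and
  \<open>f\<close> has to be injective on \<open>V\<close> only. This matters for maps such as
  truncated subtraction, which are injective only on actual positions.\<close>

lemma inc_acyclic_image:
  fixes Ed :: "'e set" and B :: "'e \<Rightarrow> 'v set" and Ed' :: "'f set" and B' :: "'f \<Rightarrow> 'u set"
  assumes g: "bij_betw g Ed Ed'" and V: "\<And>e. e \<in> Ed \<Longrightarrow> B e \<subseteq> V" and f: "inj_on f V"
    and B: "\<And>e. e \<in> Ed \<Longrightarrow> B' (g e) = f ` B e"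
    and ac: "inc_acyclic (K::'k::field itself) Ed B"
  shows "inc_acyclic K Ed' B'"
  unfolding inc_acyclic_def
proof (intro allI impI)
  fix c :: "'f \<Rightarrow> 'k"
  assume c: "\<forall>x. bsum Ed' B' c x = 0"
  have "bsum Ed B (\<lambda>e. c (g e)) x = 0" for x
  proof (cases "x \<in> V")
    case True
    have "bsum Ed B (\<lambda>e. c (g e)) x = bsum Ed' B' c (f x)"
      by (rule bsum_reindex[OF g]) (use V B True f in \<open>auto simp: inj_on_image_mem_iff\<close>)
    with c show ?thesis by simp
  next
    case False
    then show ?thesis using V by (intro bsum_eq_0) auto
  qed
  with ac have "\<forall>e\<in>Ed. c (g e) = 0" unfolding inc_acyclic_def by auto
  then show "\<forall>e\<in>Ed'. c e = 0" using g by (auto simp: bij_betw_def)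
qed

lemma inc_boundary_ex:
  assumes "inc_boundary (K::'k::field itself) Ed B v"
  shows "\<exists>e\<in>Ed. v \<in> B e"
proof (rule ccontr)
  assume n: "\<not> ?thesis"
  obtain c :: "'a \<Rightarrow> 'k" where c: "\<And>x. bsum Ed B c x = of_bool (x = v)"
    using assms by (auto simp: inc_boundary_def)
  have "bsum Ed B c v = 0" using n by (intro bsum_eq_0) auto
  with c[of v] show False by simp
qed

text \<open>A boundary vertex lies on some edge, so it has a preimage in \<open>V\<close>. The chain
  is pulled back along \<open>g\<close>, and the resulting path is pushed forward along
  \<open>f\<close>.\<close>

lemma inc_effective_image:
  fixes Ed :: "'e set" and B :: "'e \<Rightarrow> 'v set" and Ed' :: "'f set" and B' :: "'f \<Rightarrow> 'u set"
  assumes g: "bij_betw g Ed Ed'" and V: "\<And>e. e \<in> Ed \<Longrightarrow> B e \<subseteq> V" and f: "inj_on f V"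
    and B: "\<And>e. e \<in> Ed \<Longrightarrow> B' (g e) = f ` B e"
    and ac: "inc_effective (K::'k::field itself) Ed B"
  shows "inc_effective K Ed' B'"
  unfolding inc_effective_def
proof (intro allI impI)
  fix v' assume v': "inc_boundary K Ed' B' v'"
  then obtain e' where "e' \<in> Ed'" "v' \<in> B' e'" using inc_boundary_ex by metis
  then obtain e where e: "e \<in> Ed" "v' \<in> f ` B e" using g B by (auto simp: bij_betw_def)
  then obtain v where v: "v \<in> V" "v' = f v" using V by auto
  obtain c :: "'f \<Rightarrow> 'k" where c: "\<And>x. bsum Ed' B' c x = of_bool (x = v')"
    using v' by (auto simp: inc_boundary_def)
  have "bsum Ed B (\<lambda>e. c (g e)) x = of_bool (x = v)" for x
  proof (cases "x \<in> V")
    case True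
    have "bsum Ed B (\<lambda>e. c (g e)) x = bsum Ed' B' c (f x)"
      by (rule bsum_reindex[OF g]) (use V B True f in \<open>auto simp: inj_on_image_mem_iff\<close>)
    then show ?thesis using c v f True by (auto simp: inj_on_eq_iff)
  next
    case False
    then have "bsum Ed B (\<lambda>e. c (g e)) x = 0" using V by (intro bsum_eq_0) auto
    then show ?thesis using False v by auto
  qed
  then have "inc_boundary K Ed B v" unfolding inc_boundary_def by blast
  then obtain u e1 where u: "e1 \<in> Ed" "B e1 = {u}" "(inc_rel Ed B)\<^sup>*\<^sup>* v u"
    using ac unfolding inc_effective_def by blast
  have "(inc_rel Ed' B')\<^sup>*\<^sup>* (f v) (f u)"
    by (rule inc_rel_rtranclp_image[where g = g and f = f and V = V and Ed = Ed and B = B])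
       (use V f B u(3) g in \<open>auto simp: bij_betw_def\<close>)
  moreover have "g e1 \<in> Ed'" "B' (g e1) = {f u}" using u B[of e1] g by (auto simp: bij_betw_def)
  ultimately show "\<exists>u. (\<exists>e\<in>Ed'. B' e = {u}) \<and> (inc_rel Ed' B')\<^sup>*\<^sup>* v' u"
    using v(2) by blast
qed

section \<open>The incidence structure of a word\<close>

definition word_edges :: "'s list \<Rightarrow> (nat \<times> nat) set" where
  "word_edges ws = {(i, j). i < j \<and> j < length ws \<and> ws ! i = ws ! j \<and>
     (\<forall>k. i < k \<and> k < j \<longrightarrow> ws ! k \<noteq> ws ! i)}"

text \<open>No vertex with the label of an edge lies strictly between its ends, and equal or
  adjacent labels are ordered by position, so positions and adjacency alone give the boundary of the
  edge in the heap.\<close>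

definition word_bd :: "('s \<Rightarrow> 's \<Rightarrow> bool) \<Rightarrow> 's list \<Rightarrow> nat \<times> nat \<Rightarrow> nat set" where
  "word_bd adj ws e = {k. fst e < k \<and> k < snd e \<and> adj (ws ! k) (ws ! fst e)}"

abbreviation word_acyclic where
  "word_acyclic K adj ws \<equiv> inc_acyclic K (word_edges ws) (word_bd adj ws)"

abbreviation word_effective where
  "word_effective K adj ws \<equiv> inc_effective K (word_edges ws) (word_bd adj ws)"

lemma finite_word_edges [simp]: "finite (word_edges ws)"
  by (rule finite_subset[of _ "{..<length ws} \<times> {..<length ws}"]) (auto simp: word_edges_def)

lemma word_bd_subset: "e \<in> word_edges ws \<Longrightarrow> word_bd adj ws e \<subseteq> {..<length ws}"
  by (auto simp: word_edges_def word_bd_def)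

lemma word_edges_distinct: "distinct ws \<Longrightarrow> word_edges ws = {}"
  by (auto simp: word_edges_def nth_eq_iff_index_eq)

lemma inc_acyclic_empty [simp]: "inc_acyclic K {} B"
  by (simp add: inc_acyclic_def)

lemma inc_effective_empty [simp]: "inc_effective K {} B"
  using inc_boundary_ex unfolding inc_effective_def by fastforce

text \<open>Commutation moves preserve the relative order of equal or adjacent letters.\<close>

lemma word_map_edge:
  assumes len: "length ws' = length ws" and f: "bij_betw f {..<length ws} {..<length ws}"
    and lab: "\<And>i. i < length ws \<Longrightarrow> ws' ! f i = ws ! i"
    and ord: "\<And>i j. i < length ws \<Longrightarrow> j < length ws \<Longrightarrow> ws ! i = ws ! j \<or> adj (ws ! i) (ws ! j)
       \<Longrightarrow> f i < f j \<longleftrightarrow> i < j"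
    and sym: "\<And>a b. adj a b \<Longrightarrow> adj b a"
  shows "bij_betw (map_prod f f) (word_edges ws) (word_edges ws')"
    and "\<And>e. e \<in> word_edges ws \<Longrightarrow> word_bd adj ws' (map_prod f f e) = f ` word_bd adj ws e"
proof -
  have fl: "\<And>i. i < length ws \<Longrightarrow> f i < length ws" using f by (auto simp: bij_betw_def)
  have fs: "\<And>i. i < length ws \<Longrightarrow> \<exists>k<length ws. i = f k" 
    using f unfolding bij_betw_def by (metis imageE lessThan_iff)
  have finj: "inj_on f {..<length ws}" using f by (simp add: bij_betw_def)
  have E: "(f i, f j) \<in> word_edges ws' \<longleftrightarrow> (i, j) \<in> word_edges ws"
    if ij: "i < length ws" "j < length ws" for i j
  proof -
    have "(\<forall>k. f i < k \<and> k < f j \<longrightarrow> ws' ! k \<noteq> ws' ! f i) \<longleftrightarrow>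
          (\<forall>k. i < k \<and> k < j \<longrightarrow> ws ! k \<noteq> ws ! i)" if eq: "ws ! i = ws ! j"
    proof safe
      fix k assume *: "\<forall>k. f i < k \<and> k < f j \<longrightarrow> ws' ! k \<noteq> ws' ! f i"
        and k: "i < k" "k < j" "ws ! k = ws ! i"
      then show False using *[rule_format, of "f k"] ord[of i k] ord[of k j] ij eq lab by auto
    next
      fix k assume *: "\<forall>k. i < k \<and> k < j \<longrightarrow> ws ! k \<noteq> ws ! i"
        and k: "f i < k" "k < f j" "ws' ! k = ws' ! f i"
      then obtain k' where k': "k' < length ws" "k = f k'" using fs[of k] fl[of j] ij by auto
      then show False using *[rule_format, of k'] k ord[of i k'] ord[of k' j] ij eq lab by auto
    qed
    then show ?thesis using ij lab ord[of i j] fl len by (auto simp: word_edges_def)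
  qed
  show "bij_betw (map_prod f f) (word_edges ws) (word_edges ws')"
    unfolding bij_betw_def
  proof
    show "inj_on (map_prod f f) (word_edges ws)"
      using finj by (auto simp: inj_on_def word_edges_def)
    show "map_prod f f ` word_edges ws = word_edges ws'"
    proof (intro equalityI subsetI)
      fix e assume "e \<in> map_prod f f ` word_edges ws"
      then obtain i j where ij: "(i, j) \<in> word_edges ws" "e = (f i, f j)" by auto
      then have "i < length ws" "j < length ws" by (auto simp: word_edges_def)
      with ij E show "e \<in> word_edges ws'" by simp
    next
      fix e assume a: "e \<in> word_edges ws'"
      obtain i j where ij: "e = (i, j)" by force
      with a have "i < length ws" "j < length ws" using len by (auto simp: word_edges_def)
      then obtain i' j' where "i' < length ws" "j' < length ws" "i = f i'" "j = f j'" using fs by metis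
      with a ij E[of i' j'] show "e \<in> map_prod f f ` word_edges ws" by force
    qed
  qed
  fix e assume e: "e \<in> word_edges ws"
  obtain i j where ij: "e = (i, j)" by force
  with e have l: "i < length ws" "j < length ws" "ws ! i = ws ! j" by (auto simp: word_edges_def)
  show "word_bd adj ws' (map_prod f f e) = f ` word_bd adj ws e"
  proof safe
    fix k assume "k \<in> word_bd adj ws' (map_prod f f e)"
    then have k: "f i < k" "k < f j" "adj (ws' ! k) (ws' ! f i)" by (auto simp: word_bd_def ij)
    then obtain k' where k': "k' < length ws" "k = f k'" using fs[of k] fl[of j] l by auto
    then have "adj (ws ! k') (ws ! i)" using k lab l by auto
    moreover then have "i < k'" "k' < j" using ord[of i k'] ord[of k' j] k k' l sym by auto
    ultimately show "k \<in> f ` word_bd adj ws e" using k' by (auto simp: word_bd_def ij)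
  next
    fix k assume "k \<in> word_bd adj ws e"
    then have k: "i < k" "k < j" "adj (ws ! k) (ws ! i)" by (auto simp: word_bd_def ij)
    then have "f i < f k" "f k < f j" using ord[of i k] ord[of k j] l sym by auto
    then show "f k \<in> word_bd adj ws' (map_prod f f e)"
      using k l lab by (auto simp: word_bd_def ij)
  qed
qed

text \<open>The transposition reverses the order of the two swapped positions only, and their
  letters are neither equal nor adjacent.\<close>

lemma word_swap_map:
  fixes u v :: "'s list"
  assumes "s \<noteq> t" "\<not> adj s t" and sym: "\<And>a b. adj a b \<Longrightarrow> adj b a"
  defines "ws \<equiv> u @ [s, t] @ v" and "ws' \<equiv> u @ [t, s] @ v"
    and "f \<equiv> transpose (length u) (Suc (length u))"
  shows "bij_betw (map_prod f f) (word_edges ws) (word_edges ws')"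
    and "\<And>e. e \<in> word_edges ws \<Longrightarrow> word_bd adj ws' (map_prod f f e) = f ` word_bd adj ws e"
proof -
  let ?n = "length u"
  have len: "length ws' = length ws" by (simp add: ws_def ws'_def)
  have n: "ws ! ?n = s" "ws ! Suc ?n = t" by (auto simp: ws_def nth_append)
  have f: "bij_betw f {..<length ws} {..<length ws}"
    by (rule bij_betw_byWitness[where f' = f]) (auto simp: f_def transpose_def ws_def)
  have lab: "ws' ! f i = ws ! i" for i
  proof -
    consider "i < ?n" | "i = ?n" | "i = Suc ?n" | "i > Suc ?n" by linarith
    then show ?thesis by cases (auto simp: f_def transpose_def ws_def ws'_def nth_append nth_Cons')
  qed
  have ord: "f i < f j \<longleftrightarrow> i < j" if "ws ! i = ws ! j \<or> adj (ws ! i) (ws ! j)" for i j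
  proof -
    have "\<not> (i = ?n \<and> j = Suc ?n)" "\<not> (i = Suc ?n \<and> j = ?n)"
      using that n assms(1,2) sym by auto
    then show ?thesis by (auto simp: f_def transpose_def)
  qed
  show "bij_betw (map_prod f f) (word_edges ws) (word_edges ws')"
    by (rule word_map_edge(1)[OF len f lab ord sym]) auto
  show "\<And>e. e \<in> word_edges ws \<Longrightarrow> word_bd adj ws' (map_prod f f e) = f ` word_bd adj ws e"
    by (rule word_map_edge(2)[OF len f lab ord sym]) auto
qed

text \<open>Reversal exchanges the two ends of an edge. \<open>f\<close> subtracts in the naturals,
  hence is injective only on actual positions.\<close>

lemma word_rev_map:
  fixes ws :: "'s list"
  defines "f \<equiv> \<lambda>i. length ws - Suc i"
  shows "bij_betw (\<lambda>(i, j). (f j, f i)) (word_edges ws) (word_edges (rev ws))"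
    and "\<And>e. e \<in> word_edges ws \<Longrightarrow>
      word_bd adj (rev ws) ((\<lambda>(i, j). (f j, f i)) e) = f ` word_bd adj ws e"
    and "inj_on f {..<length ws}"
proof -
  have ff: "f (f i) = i" if "i < length ws" for i using that by (auto simp: f_def)
  \<comment> \<open>Stated for any word of the same length, so that it serves both \<open>ws\<close>
    and \<open>rev ws\<close> and yields both inclusions.\<close>
  have E: "(f j, f i) \<in> word_edges (rev us)" if e: "(i, j) \<in> word_edges us" and l: "length us = length ws"
    for i j and us :: "'s list"
  proof -
    have "us ! (length ws - Suc k) \<noteq> us ! j" if "f j < k" "k < f i" for k
    proof -
      have "i < length ws - Suc k" "length ws - Suc k < j" using that e l by (auto simp: f_def word_edges_def)
      then show ?thesis using e by (auto simp: word_edges_def)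
    qed
    then show ?thesis using e l by (auto simp: word_edges_def f_def rev_nth)
  qed
  show "bij_betw (\<lambda>(i, j). (f j, f i)) (word_edges ws) (word_edges (rev ws))"
  proof (rule bij_betw_byWitness[where f' = "\<lambda>(i, j). (f j, f i)"])
    show "\<forall>a\<in>word_edges ws. (case case a of (i, j) \<Rightarrow> (f j, f i) of (i, j) \<Rightarrow> (f j, f i)) = a"
      by (auto simp: word_edges_def ff)
    show "\<forall>a'\<in>word_edges (rev ws). (case case a' of (i, j) \<Rightarrow> (f j, f i) of (i, j) \<Rightarrow> (f j, f i)) = a'"
      by (auto simp: word_edges_def ff)
    show "(\<lambda>(i, j). (f j, f i)) ` word_edges ws \<subseteq> word_edges (rev ws)" using E[of _ _ ws] by auto
    show "(\<lambda>(i, j). (f j, f i)) ` word_edges (rev ws) \<subseteq> word_edges ws" using E[of _ _ "rev ws"] by auto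
  qed
  show "inj_on f {..<length ws}" by (auto simp: inj_on_def f_def)
  fix e assume e: "e \<in> word_edges ws"
  obtain i j where ij: "e = (i, j)" by force
  with e have l: "i < j" "j < length ws" "ws ! i = ws ! j" by (auto simp: word_edges_def)
  show "word_bd adj (rev ws) ((\<lambda>(i, j). (f j, f i)) e) = f ` word_bd adj ws e"
  proof safe
    fix k assume "k \<in> word_bd adj (rev ws) ((\<lambda>(i, j). (f j, f i)) e)"
    then have "f j < k" "k < f i" "adj (ws ! f k) (ws ! i)"
      using l by (auto simp: word_bd_def ij rev_nth f_def)
    then have "f k \<in> word_bd adj ws e" "k = f (f k)" using l by (auto simp: word_bd_def ij f_def)
    then show "k \<in> f ` word_bd adj ws e" by blast
  next
    fix k assume "k \<in> word_bd adj ws e"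
    then show "f k \<in> word_bd adj (rev ws) ((\<lambda>(i, j). (f j, f i)) e)"
      using l by (auto simp: word_bd_def ij f_def rev_nth)
  qed
qed

lemma word_swap_acyclic:
  assumes "s \<noteq> t" "\<not> adj s t" "\<And>a b. adj a b \<Longrightarrow> adj b a"
    and "word_acyclic K adj (u @ [s, t] @ v)"
  shows "word_acyclic K adj (u @ [t, s] @ v)"
proof -
  note m = word_swap_map[where s = s and t = t and adj = adj and u = u and v = v, OF assms(1-3)]
  show ?thesis
    by (rule inc_acyclic_image[where V = UNIV and Ed = "word_edges (u @ [s, t] @ v)"
          and B = "word_bd adj (u @ [s, t] @ v)", OF m(1) _ _ m(2) assms(4)]) auto
qed

lemma word_swap_effective:
  assumes "s \<noteq> t" "\<not> adj s t" "\<And>a b. adj a b \<Longrightarrow> adj b a"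
    and "word_effective K adj (u @ [s, t] @ v)"
  shows "word_effective K adj (u @ [t, s] @ v)"
proof -
  note m = word_swap_map[where s = s and t = t and adj = adj and u = u and v = v, OF assms(1-3)]
  show ?thesis
    by (rule inc_effective_image[where V = UNIV and Ed = "word_edges (u @ [s, t] @ v)"
          and B = "word_bd adj (u @ [s, t] @ v)", OF m(1) _ _ m(2) assms(4)]) auto
qed

lemma word_rev_acyclic:
  assumes "word_acyclic K adj ws"
  shows "word_acyclic K adj (rev ws)"
proof -
  note m = word_rev_map[where ws = ws]
  show ?thesis
    by (rule inc_acyclic_image[where V = "{..<length ws}" and Ed = "word_edges ws"
          and B = "word_bd adj ws", OF m(1) word_bd_subset m(3) m(2) assms])
qed

lemma word_rev_effective:
  assumes "word_effective K adj ws"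
  shows "word_effective K adj (rev ws)"
proof -
  note m = word_rev_map[where ws = ws]
  show ?thesis
    by (rule inc_effective_image[where V = "{..<length ws}" and Ed = "word_edges ws"
          and B = "word_bd adj ws", OF m(1) word_bd_subset m(3) m(2) assms])
qed

section \<open>Prepending a letter to a word\<close>

lemma word_edges_Cons:
  "word_edges (s # ws) = map_prod Suc Suc ` word_edges ws \<union>
     {(0, Suc j) | j. j < length ws \<and> ws ! j = s \<and> (\<forall>k<j. ws ! k \<noteq> s)}" (is "?L = ?R")
proof (rule Set.set_eqI)
  fix e :: "nat \<times> nat"
  obtain i j where e: "e = (i, j)" by force
  have all: "(\<forall>k. P k) \<longleftrightarrow> P 0 \<and> (\<forall>k. P (Suc k))" for P :: "nat \<Rightarrow> bool"
    using not0_implies_Suc by metis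
  show "e \<in> ?L \<longleftrightarrow> e \<in> ?R"
  proof (cases i)
    case 0
    show ?thesis
    proof (cases j)
      case 0 then show ?thesis using e \<open>i = 0\<close> by (auto simp: word_edges_def)
    next
      case (Suc j')
      have "(\<forall>k. 0 < k \<and> k < Suc j' \<longrightarrow> (s # ws) ! k \<noteq> s) \<longleftrightarrow> (\<forall>k<j'. ws ! k \<noteq> s)"
        by (subst all) simp
      then show ?thesis using e 0 Suc by (auto simp: word_edges_def)
    qed
  next
    case (Suc i')
    show ?thesis
    proof (cases j)
      case 0 then show ?thesis using e Suc by (auto simp: word_edges_def)
    next
      case (Suc j')
      have "(\<forall>k. Suc i' < k \<and> k < Suc j' \<longrightarrow> (s # ws) ! k \<noteq> ws ! i') \<longleftrightarrow>
        (\<forall>k. i' < k \<and> k < j' \<longrightarrow> ws ! k \<noteq> ws ! i')"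
        by (subst all) simp
      then show ?thesis using e Suc \<open>i = Suc i'\<close> by (force simp: word_edges_def)
    qed
  qed
qed

lemma word_bd_Cons: "word_bd adj (s # ws) (map_prod Suc Suc e) = Suc ` word_bd adj ws e"
proof (rule Set.set_eqI)
  fix k show "k \<in> word_bd adj (s # ws) (map_prod Suc Suc e) \<longleftrightarrow> k \<in> Suc ` word_bd adj ws e"
    by (cases k) (auto simp: word_bd_def)
qed

lemma word_edges_Cons_notin:
  "s \<notin> set ws \<Longrightarrow> word_edges (s # ws) = map_prod Suc Suc ` word_edges ws"
  by (auto simp: word_edges_Cons)

lemma word_edges_Cons_in:
  assumes "s \<in> set ws"
  obtains j where "j < length ws" "ws ! j = s" "\<forall>k<j. ws ! k \<noteq> s"
    "word_edges (s # ws) = insert (0, Suc j) (map_prod Suc Suc ` word_edges ws)"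
proof -
  let ?P = "\<lambda>j. j < length ws \<and> ws ! j = s"
  define j where "j = (LEAST j. ?P j)"
  have "\<exists>j. ?P j" using assms by (auto simp: in_set_conv_nth)
  then have j: "?P j" unfolding j_def by (rule LeastI_ex)
  have k: "\<forall>k<j. ws ! k \<noteq> s" using not_less_Least j unfolding j_def by fastforce
  have "{(0::nat, Suc j) | j. j < length ws \<and> ws ! j = s \<and> (\<forall>k<j. ws ! k \<noteq> s)} = {(0, Suc j)}"
    using j k by (auto) (metis linorder_neqE_nat)
  then have "word_edges (s # ws) = insert (0, Suc j) (map_prod Suc Suc ` word_edges ws)"
    unfolding word_edges_Cons by simp
  with that j k show ?thesis by blast
qed

lemma bsum_word_shift:
  "bsum (map_prod Suc Suc ` word_edges ws) (word_bd adj (s # ws)) c (Suc x) =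
   bsum (word_edges ws) (word_bd adj ws) (\<lambda>e. c (map_prod Suc Suc e)) x"
  by (rule bsum_reindex[symmetric])
     (auto simp: bij_betw_def inj_on_def word_bd_Cons)

lemma bsum_word_first: "bsum (word_edges ws) (word_bd adj ws) c 0 = 0"
  by (rule bsum_eq_0) (auto simp: word_bd_def)

lemma bsum_insert:
  "finite Ed \<Longrightarrow> e \<notin> Ed \<Longrightarrow> bsum (insert e Ed) B c x = (if x \<in> B e then c e else 0) + bsum Ed B c x"
  by (simp add: bsum_def)

lemma bsum_Cons_Cons:
  assumes j: "word_edges (s # t # ws) = insert (0, Suc j) (map_prod Suc Suc ` word_edges (t # ws))"
  shows "bsum (word_edges (s # t # ws)) (word_bd adj (s # t # ws)) c (Suc x) =
    (if Suc x \<in> word_bd adj (s # t # ws) (0, Suc j) then c (0, Suc j) else 0) +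
    bsum (word_edges (t # ws)) (word_bd adj (t # ws)) (\<lambda>e. c (map_prod Suc Suc e)) x"
  unfolding j by (subst bsum_insert) (auto simp: bsum_word_shift)

text \<open>\<open>j = 0\<close> would force \<open>t = s\<close>, so position 1, which carries
  \<open>t\<close>, lies strictly inside the edge.\<close>

lemma one_mem_word_bd:
  assumes "adj t s" "s \<noteq> t" "(t # ws) ! j = s"
  shows "Suc 0 \<in> word_bd adj (s # t # ws) (0, Suc j)"
  using assms by (cases j) (auto simp: word_bd_def)

lemma word_acyclic_step:
  assumes adj: "adj t s" "s \<noteq> t" and ac: "word_acyclic (K::'k::field itself) adj (t # ws)"
  shows "word_acyclic K adj (s # t # ws)"
  unfolding inc_acyclic_def
proof (intro allI impI)
  fix c :: "nat \<times> nat \<Rightarrow> 'k"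
  assume c: "\<forall>x. bsum (word_edges (s # t # ws)) (word_bd adj (s # t # ws)) c x = 0"
  show "\<forall>e\<in>word_edges (s # t # ws). c e = 0"
  proof (cases "s \<in> set (t # ws)")
    case False
    have "bsum (word_edges (t # ws)) (word_bd adj (t # ws)) (\<lambda>e. c (map_prod Suc Suc e)) x = 0" for x
      using c[rule_format, of "Suc x"] unfolding word_edges_Cons_notin[OF False] bsum_word_shift .
    with ac show ?thesis unfolding inc_acyclic_def word_edges_Cons_notin[OF False] by auto
  next
    case True
    then obtain j where j: "j < length (t # ws)" "(t # ws) ! j = s"
      "word_edges (s # t # ws) = insert (0, Suc j) (map_prod Suc Suc ` word_edges (t # ws))"
      by (rule word_edges_Cons_in)
    \<comment> \<open>The vertex of \<open>t\<close> is the first position of \<open>t # ws\<close>,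
      where no chain of \<open>t # ws\<close> has a boundary coefficient; only the new edge is
      left.\<close>
    have c0: "c (0, Suc j) = 0"
      using c[rule_format, of "Suc 0"] one_mem_word_bd[of adj, OF adj j(2)]
      unfolding bsum_Cons_Cons[OF j(3)] bsum_word_first by simp
    have "bsum (word_edges (t # ws)) (word_bd adj (t # ws)) (\<lambda>e. c (map_prod Suc Suc e)) x = 0" for x
      using c[rule_format, of "Suc x"] c0 unfolding bsum_Cons_Cons[OF j(3)] by (simp split: if_splits)
    with ac c0 show ?thesis unfolding inc_acyclic_def j(3) by auto
  qed
qed

lemma bsum_uminus: "bsum Ed B (\<lambda>e. - c e) x = - bsum Ed B c x"
  by (simp add: bsum_def sum_negf[symmetric] if_distrib cong: if_cong)

text \<open>Prepending a letter keeps all edges and shifts their boundaries, so paths and effective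
  vertices of \<open>ws\<close> survive.\<close>

lemma word_effective_lift:
  assumes "word_effective K adj ws" "inc_boundary K (word_edges ws) (word_bd adj ws) v"
  shows "\<exists>u. (\<exists>e\<in>word_edges (s # ws). word_bd adj (s # ws) e = {u}) \<and>
     (inc_rel (word_edges (s # ws)) (word_bd adj (s # ws)))\<^sup>*\<^sup>* (Suc v) u"
proof -
  obtain u e where u: "e \<in> word_edges ws" "word_bd adj ws e = {u}"
      "(inc_rel (word_edges ws) (word_bd adj ws))\<^sup>*\<^sup>* v u"
    using assms unfolding inc_effective_def by blast
  have "(inc_rel (word_edges (s # ws)) (word_bd adj (s # ws)))\<^sup>*\<^sup>* (Suc v) (Suc u)"
    by (rule inc_rel_rtranclp_image[OF _ _ _ _ u(3), where V = UNIV and g = "map_prod Suc Suc"])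
       (auto simp: word_bd_Cons word_edges_Cons)
  moreover have "map_prod Suc Suc e \<in> word_edges (s # ws)"
    using u(1) by (auto simp: word_edges_Cons)
  moreover have "word_bd adj (s # ws) (map_prod Suc Suc e) = {Suc u}"
    by (simp add: word_bd_Cons u)
  ultimately show ?thesis by blast
qed

text \<open>
  Deleting the letter \<open>t\<close> after the first letter does not change the boundaries of the edges
  in the colour class of \<open>s\<close>, apart from the deleted vertex.
\<close>

lemma word_drop_second_edges:
  fixes s t :: 's and ws :: "'s list"
  defines "h \<equiv> \<lambda>k::nat. if k = 0 then 0 else Suc k"
  shows "bij_betw (map_prod h h) {e \<in> word_edges (s # ws). (s # ws) ! fst e \<noteq> t}
           {e \<in> word_edges (s # t # ws). (s # t # ws) ! fst e \<noteq> t}"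
    and "(s # t # ws) ! h k = (s # ws) ! k"
    and "h k \<in> word_bd adj (s # t # ws) (map_prod h h e) \<longleftrightarrow> k \<in> word_bd adj (s # ws) e"
proof -
  have n: "(s # t # ws) ! h k = (s # ws) ! k" for k by (cases k) (auto simp: h_def)
  have ho: "h i < h j \<longleftrightarrow> i < j" for i j by (auto simp: h_def)
  \<comment> \<open>\<open>h\<close> enumerates all positions except 1, the place of the deleted
    \<open>t\<close>.\<close>
  have hs: "k = Suc 0 \<or> (\<exists>k'. k = h k')" for k
    by (cases k; cases "k - 1") (auto simp: h_def)
  have hl: "h j < Suc (Suc (length ws)) \<longleftrightarrow> j < Suc (length ws)" for j by (auto simp: h_def)
  show "(s # t # ws) ! h k = (s # ws) ! k" by (rule n)
  show "h k \<in> word_bd adj (s # t # ws) (map_prod h h e) \<longleftrightarrow> k \<in> word_bd adj (s # ws) e"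
    by (simp add: word_bd_def ho n)
  have E: "(h i, h j) \<in> word_edges (s # t # ws) \<longleftrightarrow> (i, j) \<in> word_edges (s # ws)"
    if t: "(s # ws) ! i \<noteq> t" for i j
  proof -
    have "(\<forall>k. h i < k \<and> k < h j \<longrightarrow> (s # t # ws) ! k \<noteq> (s # ws) ! i) \<longleftrightarrow>
      (\<forall>k. i < k \<and> k < j \<longrightarrow> (s # ws) ! k \<noteq> (s # ws) ! i)" (is "?a \<longleftrightarrow> ?b")
    proof
      assume a: ?a
      show ?b
      proof (intro allI impI)
        fix k assume "i < k \<and> k < j"
        then show "(s # ws) ! k \<noteq> (s # ws) ! i" using a[rule_format, of "h k"] by (simp add: ho n)
      qed
    next
      assume b: ?b
      show ?a
      proof (intro allI impI)
        fix k assume k: "h i < k \<and> k < h j"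
        show "(s # t # ws) ! k \<noteq> (s # ws) ! i"
        proof (cases "k = Suc 0")
          \<comment> \<open>Position 1 carries \<open>t\<close>, so it cannot interrupt an edge with
            another label.\<close>
          case True then show ?thesis using t by simp
        next
          case False
          then obtain k' where k': "k = h k'" using hs by blast
          then show ?thesis using b[rule_format, of k'] k by (simp add: ho n)
        qed
      qed
    qed
    then show ?thesis by (simp add: word_edges_def ho n hl)
  qed
  show "bij_betw (map_prod h h) {e \<in> word_edges (s # ws). (s # ws) ! fst e \<noteq> t}
           {e \<in> word_edges (s # t # ws). (s # t # ws) ! fst e \<noteq> t}"
    unfolding bij_betw_def
  proof
    show "inj_on (map_prod h h) {e \<in> word_edges (s # ws). (s # ws) ! fst e \<noteq> t}"
      by (auto simp: inj_on_def h_def split: if_splits)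
    show "map_prod h h ` {e \<in> word_edges (s # ws). (s # ws) ! fst e \<noteq> t} =
      {e \<in> word_edges (s # t # ws). (s # t # ws) ! fst e \<noteq> t}"
    proof (intro equalityI subsetI)
      fix e assume "e \<in> map_prod h h ` {e \<in> word_edges (s # ws). (s # ws) ! fst e \<noteq> t}"
      then show "e \<in> {e \<in> word_edges (s # t # ws). (s # t # ws) ! fst e \<noteq> t}"
        using E by (auto simp: n)
    next
      fix e assume "e \<in> {e \<in> word_edges (s # t # ws). (s # t # ws) ! fst e \<noteq> t}"
      then obtain i j where e: "e = (i, j)" "(i, j) \<in> word_edges (s # t # ws)" "(s # t # ws) ! i \<noteq> t"
        by (cases e) auto
      then have "i \<noteq> Suc 0" "j \<noteq> Suc 0" by (auto simp: word_edges_def)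
      then obtain i' j' where "i = h i'" "j = h j'" using hs by metis
      then show "e \<in> map_prod h h ` {e \<in> word_edges (s # ws). (s # ws) ! fst e \<noteq> t}"
        using e E[of i' j'] by (force simp: n)
    qed
  qed
qed

text \<open>Restricting \<open>c\<close> to the colour class of \<open>s\<close> discards the edges
  labelled \<open>t\<close>, which the deletion may destroy. The boundary of an edge lies in the
  opposite colour class, so the restricted chain still has the vertex of \<open>t\<close> as its
  boundary and becomes a cycle once that vertex is deleted.\<close>

lemma word_drop_second_kernel:
  fixes c :: "nat \<times> nat \<Rightarrow> 'k::field" and col :: "'s \<Rightarrow> bool"
  assumes col: "\<And>a b. adj a b \<Longrightarrow> col a \<noteq> col b" and adj: "adj t s"
    and c: "\<And>x. bsum (word_edges (s # t # ws)) (word_bd adj (s # t # ws)) c x = of_bool (x = Suc 0)"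
    and ac: "word_acyclic TYPE('k) adj (s # ws)"
    and e: "(0, j) \<in> word_edges (s # t # ws)"
  shows "c (0, j) = 0"
proof -
  define h where "h = (\<lambda>k::nat. if k = 0 then 0 else Suc k)"
  define W where "W = s # t # ws"
  define U where "U = s # ws"
  note h = word_drop_second_edges[where s = s and t = t and ws = ws, folded W_def U_def]
  have hb: "bij_betw (map_prod h h) {e \<in> word_edges U. U ! fst e \<noteq> t} {e \<in> word_edges W. W ! fst e \<noteq> t}"
    unfolding h_def by (rule h(1))
  have hn: "W ! h k = U ! k" for k unfolding h_def by (rule h(2))
  have hm: "h k \<in> word_bd adj W (map_prod h h e) \<longleftrightarrow> k \<in> word_bd adj U e" for k e
    unfolding h_def by (rule h(3))
  define cA where "cA e = (if col (W ! fst e) = col s then c e else 0)" for e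
  have ct: "col t \<noteq> col s" using col adj by blast
  have s1: "bsum (word_edges U) (word_bd adj U) (\<lambda>e. cA (map_prod h h e)) x = 0" for x
  proof -
    \<comment> \<open>Edges labelled \<open>t\<close> carry coefficient 0 in \<open>cA\<close>, so
      the two words may be compared on the remaining edges.\<close>
    have "bsum (word_edges U) (word_bd adj U) (\<lambda>e. cA (map_prod h h e)) x =
      bsum {e \<in> word_edges U. U ! fst e \<noteq> t} (word_bd adj U) (\<lambda>e. cA (map_prod h h e)) x"
      unfolding bsum_def by (rule sum.mono_neutral_right) (use ct hn in \<open>auto simp: cA_def\<close>)
    also have "\<dots> = bsum {e \<in> word_edges W. W ! fst e \<noteq> t} (word_bd adj W) cA (h x)"
      by (rule bsum_reindex[OF hb]) (simp add: hm)
    also have "\<dots> = bsum (word_edges W) (word_bd adj W) cA (h x)"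
      unfolding bsum_def by (rule sum.mono_neutral_left) (use ct in \<open>auto simp: cA_def\<close>)
    \<comment> \<open>At a vertex coloured like \<open>s\<close> no retained edge contributes; at
      any other vertex all contributing edges are retained, and \<open>h x\<close> avoids the vertex
      of \<open>t\<close>.\<close>
    also have "\<dots> = 0"
    proof (cases "col (W ! h x) = col s")
      case True
      have "\<And>e. h x \<in> word_bd adj W e \<Longrightarrow> cA e = 0"
        using True col by (fastforce simp: word_bd_def cA_def)
      then show ?thesis unfolding bsum_def by (intro sum.neutral) auto
    next
      case False
      have "cA e = c e" if "h x \<in> word_bd adj W e" for e
        using False col[of "W ! h x" "W ! fst e"] that by (auto simp: word_bd_def cA_def)
      then have "bsum (word_edges W) (word_bd adj W) cA (h x) = bsum (word_edges W) (word_bd adj W) c (h x)"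
        unfolding bsum_def by (intro sum.cong) auto
      also have "h x \<noteq> Suc 0" by (simp add: h_def)
      ultimately show ?thesis using c[of "h x"] by (simp add: W_def)
    qed
    finally show ?thesis .
  qed
  have s2: "\<forall>e\<in>word_edges U. cA (map_prod h h e) = 0"
    using ac s1 unfolding inc_acyclic_def U_def by blast
  have "(0, j) \<in> {e \<in> word_edges W. W ! fst e \<noteq> t}" using e ct by (auto simp: W_def)
  then have "(0, j) \<in> map_prod h h ` {e \<in> word_edges U. U ! fst e \<noteq> t}"
    using hb by (simp add: bij_betw_def)
  then have "cA (0, j) = 0" using s2 by (elim imageE) simp
  then show ?thesis by (simp add: cA_def W_def)
qed

text \<open>Acyclicity of \<open>s # ws\<close> is demanded only when at least two vertices besides
  that of \<open>t\<close> lie in the boundary of the new edge; \<open>good_drop_second\<close>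
  makes it available in that situation.\<close>

lemma word_effective_step:
  fixes col :: "'s \<Rightarrow> bool"
  assumes col: "\<And>a b. adj a b \<Longrightarrow> col a \<noteq> col b" and adj: "adj t s"
    and ac: "\<And>j x y. (0, j) \<in> word_edges (s # t # ws) \<Longrightarrow>
       x \<in> word_bd adj (s # t # ws) (0, j) - {Suc 0} \<Longrightarrow> y \<in> word_bd adj (s # t # ws) (0, j) - {Suc 0}
       \<Longrightarrow> x \<noteq> y \<Longrightarrow> word_acyclic TYPE('k) adj (s # ws)"
    and ef: "word_effective (TYPE('k::field)) adj (t # ws)"
  shows "word_effective TYPE('k) adj (s # t # ws)"
  unfolding inc_effective_def
proof (intro allI impI)
  let ?W = "s # t # ws"
  let ?E = "word_edges ?W" and ?B = "word_bd adj ?W"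
  let ?goal = "\<lambda>v. \<exists>u. (\<exists>e\<in>?E. ?B e = {u}) \<and> (inc_rel ?E ?B)\<^sup>*\<^sup>* v u"
  fix v assume v: "inc_boundary TYPE('k) ?E ?B v"
  then obtain c :: "nat \<times> nat \<Rightarrow> 'k" where c: "\<And>x. bsum ?E ?B c x = of_bool (x = v)"
    by (auto simp: inc_boundary_def)
  let ?c = "\<lambda>e. c (map_prod Suc Suc e)"
  have st: "s \<noteq> t" using col adj by blast
  have "v \<noteq> 0" using c[of 0] bsum_word_first[of ?W adj c] by auto
  then obtain w where w: "v = Suc w" by (cases v) auto
  have IH: "?goal v" if "\<And>x. bsum (word_edges (t # ws)) (word_bd adj (t # ws)) ?c x = of_bool (x = w)"
  proof -
    have "inc_boundary TYPE('k) (word_edges (t # ws)) (word_bd adj (t # ws)) w"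
      unfolding inc_boundary_def using that by blast
    from word_effective_lift[OF ef this, of s] show ?thesis unfolding w .
  qed
  show "?goal v"
  proof (cases "s \<in> set (t # ws)")
    case False
    show ?thesis
    proof (rule IH)
      fix x show "bsum (word_edges (t # ws)) (word_bd adj (t # ws)) ?c x = of_bool (x = w)"
        using c[of "Suc x"] unfolding word_edges_Cons_notin[OF False] bsum_word_shift w by simp
    qed
  next
    case True
    then obtain j where j: "j < length (t # ws)" "(t # ws) ! j = s"
      "?E = insert (0, Suc j) (map_prod Suc Suc ` word_edges (t # ws))"
      by (rule word_edges_Cons_in)
    let ?e = "(0, Suc j)"
    have e: "?e \<in> ?E" using j(3) by blast
    have one: "Suc 0 \<in> ?B ?e" by (rule one_mem_word_bd[of adj, OF adj st j(2)])
    show ?thesis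
    proof (cases "c ?e = 0")
      case True
      show ?thesis
      proof (rule IH)
        fix x show "bsum (word_edges (t # ws)) (word_bd adj (t # ws)) ?c x = of_bool (x = w)"
          using c[of "Suc x"] True unfolding bsum_Cons_Cons[OF j(3)] w by (auto split: if_splits)
      qed
    next
      case False
      \<comment> \<open>Compare coefficients at the vertex of \<open>t\<close>: if the new edge is
        used at all, then \<open>v\<close> is this vertex and the coefficient is 1.\<close>
      have "c ?e = of_bool (Suc 0 = v)"
        using c[of "Suc 0"] one unfolding bsum_Cons_Cons[OF j(3)] bsum_word_first by simp
      with False have v1: "v = Suc 0" and ce: "c ?e = 1" by (auto split: if_splits)
      define Z where "Z = ?B ?e - {Suc 0}"
      have BZ: "?B ?e = insert (Suc 0) Z" using one by (auto simp: Z_def)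
      consider "Z = {}" | z where "Z = {z}" | x y where "x \<in> Z" "y \<in> Z" "x \<noteq> y" by blast
      then show ?thesis
      proof cases
        case 1
        then have "?B ?e = {v}" using BZ v1 by simp
        then show ?thesis using e by blast
      next
        case (2 z)
        then have z: "z \<noteq> Suc 0" "z \<in> ?B ?e" by (auto simp: Z_def)
        then obtain z' where z': "z = Suc z'" by (cases z) (auto simp: word_bd_def)
        \<comment> \<open>The new edge has boundary \<open>v + z\<close> and coefficient 1, so the
          remaining edges have total boundary \<open>- z\<close>; their negation exhibits
          \<open>z\<close> as a boundary vertex of \<open>t # ws\<close>.\<close>
        have "bsum (word_edges (t # ws)) (word_bd adj (t # ws)) (\<lambda>e. - ?c e) x = of_bool (x = z')" for x
        proof -
          have "of_bool (Suc x \<in> ?B ?e) + bsum (word_edges (t # ws)) (word_bd adj (t # ws)) ?c x = of_bool (x = 0)"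
            using c[of "Suc x"] ce unfolding bsum_Cons_Cons[OF j(3)] v1
            by (cases "Suc x \<in> ?B ?e"; cases "x = 0") auto
          moreover have "Suc x \<in> ?B ?e \<longleftrightarrow> x = 0 \<or> x = z'" unfolding BZ 2 z' by auto
          ultimately show ?thesis
            using z(1) unfolding bsum_uminus z' by (cases "x = 0"; cases "x = z'") (auto simp: add_eq_0_iff)
        qed
        then have "inc_boundary TYPE('k) (word_edges (t # ws)) (word_bd adj (t # ws)) z'"
          unfolding inc_boundary_def by blast
        from word_effective_lift[OF ef this, of s] have "?goal z" unfolding z' .
        moreover have "inc_rel ?E ?B v z"
          unfolding inc_rel_def using e BZ 2 v1 z(1) by blast
        ultimately show ?thesis by (meson converse_rtranclp_into_rtranclp)
      next
        case 3
        have "word_acyclic TYPE('k) adj (s # ws)"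
          by (rule ac[OF e 3[unfolded Z_def]])
        from word_drop_second_kernel[of adj col, OF col adj c[unfolded v1] this e] ce
        show ?thesis by simp
      qed
    qed
  qed
qed

section \<open>Alternating words\<close>

lemma length_alt [simp]: "length (alt s t n) = n"
  by (induction n arbitrary: s t) auto

lemma set_alt_subset: "set (alt s t n) \<subseteq> {s, t}"
  by (induction n arbitrary: s t) auto

lemma alt_add: "alt s t (k + j) = alt s t k @ (if even k then alt s t j else alt t s j)"
  by (induction k arbitrary: s t) auto

lemma alt_Suc_snoc: "alt s t (Suc n) = alt s t n @ [if even n then s else t]"
  using alt_add[of s t n 1] by auto

text \<open>For \<open>k > 0\<close> the reversed word ends in \<open>t\<close>, so a word starting
  with \<open>s\<close> continues the alternation; the parity of \<open>k\<close> decides the first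
  letter.\<close>

lemma rev_alt_append:
  "rev (alt t s k) @ alt s t n = (if even k then alt s t (k + n) else alt t s (k + n))"
proof (induction k arbitrary: s t n)
  case (Suc k)
  have "rev (alt t s (Suc k)) @ alt s t n = rev (alt s t k) @ alt t s (Suc n)" by simp
  also have "\<dots> = (if even k then alt t s (k + Suc n) else alt s t (k + Suc n))" by (rule Suc.IH)
  finally show ?case by simp
qed auto

lemma rev_alt: "rev (alt t s k) = (if even k then alt s t k else alt t s k)"
  using rev_alt_append[of t s k 0] by simp

lemma alt_double: "alt s t (2 * n) = concat (replicate n [s, t])"
  by (induction n) auto

section \<open>Coxeter systems\<close>

context coxeter_system
begin

abbreviation wp :: "'a list \<Rightarrow> 'a" where "wp \<equiv> word_prod G"

lemma S_sub: "s \<in> S \<Longrightarrow> s \<in> carrier G"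
  using presentation by (auto simp: has_presentation_def)

lemma wp_Nil [simp]: "wp [] = \<one>" and wp_Cons [simp]: "wp (s # ws) = s \<otimes> wp ws"
  by (simp_all add: word_prod_def)

lemma wp_closed [simp]: "set ws \<subseteq> S \<Longrightarrow> wp ws \<in> carrier G"
  by (induction ws) (auto simp: S_sub)

lemma wp_append [simp]: "set u \<subseteq> S \<Longrightarrow> set v \<subseteq> S \<Longrightarrow> wp (u @ v) = wp u \<otimes> wp v"
  by (induction u) (auto simp: S_sub m_assoc)

lemma m_self: "s \<in> S \<Longrightarrow> m s s = 1"
  and m_sym: "s \<in> S \<Longrightarrow> t \<in> S \<Longrightarrow> m s t = m t s"
  and m_ge_2: "s \<in> S \<Longrightarrow> t \<in> S \<Longrightarrow> s \<noteq> t \<Longrightarrow> 2 \<le> m s t"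
  using coxeter_matrix by (auto simp: coxeter_matrix_def)

lemma signed_val_plain: "signed_val G (map (\<lambda>s. (s, True)) ws) = wp ws"
  by (simp add: signed_val_def comp_def)

lemma plain_in_lists: "set ws \<subseteq> S \<Longrightarrow> map (\<lambda>s. (s, True)) ws \<in> lists (S \<times> UNIV)"
  by (induction ws) auto

lemma wp_eq_iff:
  assumes "set u \<subseteq> S" "set v \<subseteq> S"
  shows "wp u = wp v \<longleftrightarrow> equivclp (pres_step S (coxeter_relators S m))
    (map (\<lambda>s. (s, True)) u) (map (\<lambda>s. (s, True)) v)"
  using presentation plain_in_lists[OF assms(1)] plain_in_lists[OF assms(2)]
  unfolding has_presentation_def signed_val_plain[symmetric] by blast

lemma relation:
  assumes "s \<in> S" "t \<in> S" "m s t = enat n"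
  shows "wp (alt s t (2 * n)) = \<one>"
proof -
  let ?r = "concat (replicate n [(s, True), (t, True)])"
  have "?r \<in> coxeter_relators S m" using assms by (auto simp: coxeter_relators_def)
  then have "pres_step S (coxeter_relators S m) ([] @ ?r @ []) ([] @ [])" by (rule pres_step.relator)
  then have "equivclp (pres_step S (coxeter_relators S m)) ?r []" by (simp add: r_into_equivclp)
  moreover have "map (\<lambda>s. (s, True)) (alt s t (2 * n)) = ?r"
    unfolding alt_double by (induction n) auto
  moreover have "set (alt s t (2 * n)) \<subseteq> S" using set_alt_subset[of s t "2 * n"] assms by auto
  ultimately show ?thesis using wp_eq_iff[of "alt s t (2 * n)" "[]"] by simp
qed

lemma S_invol [simp]: "s \<in> S \<Longrightarrow> s \<otimes> s = \<one>"
  using relation[of s s 1] m_self S_sub by (simp add: one_enat_def numeral_2_eq_2)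

lemma S_inv [simp]: "s \<in> S \<Longrightarrow> inv s = s"
  using S_invol S_sub inv_equality by blast

lemma S_cancel [simp]: "s \<in> S \<Longrightarrow> g \<in> carrier G \<Longrightarrow> s \<otimes> (s \<otimes> g) = g"
  using S_sub by (simp add: m_assoc[symmetric])

lemma inv_wp: "set ws \<subseteq> S \<Longrightarrow> inv (wp ws) = wp (rev ws)"
  by (induction ws) (auto simp: inv_mult_group S_sub)

lemma wp_surj: "w \<in> carrier G \<Longrightarrow> \<exists>ws. set ws \<subseteq> S \<and> wp ws = w"
proof -
  assume "w \<in> carrier G"
  then have "w \<in> generate G S" using presentation by (simp add: has_presentation_def)
  then show ?thesis
  proof induction
    case one then show ?case by (intro exI[of _ "[]"]) auto
  next
    case (incl h) then show ?case by (intro exI[of _ "[h]"]) (auto simp: S_sub)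
  next
    case (inv h) then show ?case by (intro exI[of _ "[h]"]) (auto simp: S_sub)
  next
    case (eng h1 h2)
    then obtain u v where "set u \<subseteq> S" "set v \<subseteq> S" "wp u = h1" "wp v = h2" by blast
    then show ?case by (intro exI[of _ "u @ v"]) auto
  qed
qed

subsection \<open>Actions defined by generators and relations\<close>

text \<open>Von Dyck's theorem: maps satisfying the defining relations depend only on the group
  element. The order of \<open>s t\<close> and the exchange condition both come from suitable
  choices of \<open>\<rho>\<close>.\<close>

lemma presentation_action:
  fixes \<rho> :: "'a \<Rightarrow> 'z \<Rightarrow> 'z"
  assumes rel: "\<And>s t n. s \<in> S \<Longrightarrow> t \<in> S \<Longrightarrow> m s t = enat n \<Longrightarrow> (\<rho> s \<circ> \<rho> t) ^^ n = id"
    and ws: "set u \<subseteq> S" "set v \<subseteq> S" "wp u = wp v"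
  shows "foldr \<rho> u = foldr \<rho> v"
proof -
  \<comment> \<open>Signs are ignored: the relation for \<open>m s s = 1\<close> makes each
    \<open>\<rho> s\<close> its own inverse.\<close>
  define act where "act = foldr (\<lambda>(s, b::bool). \<rho> s)"
  have invol: "\<rho> s (\<rho> s z) = z" if "s \<in> S" for s z
    using rel[OF that that, of 1] m_self[OF that] by (auto simp: one_enat_def dest: fun_cong)
  have rep: "foldr (\<lambda>(s, b). \<rho> s) (concat (replicate n [(s, True), (t, True)])) = (\<rho> s \<circ> \<rho> t) ^^ n" for s t n
    by (induction n) (auto simp: fun_eq_iff)
  have step: "act x = act y" if "pres_step S (coxeter_relators S m) x y" for x y
    using that
  proof cases
    case (cancel s u b v)
    then show ?thesis using invol by (auto simp: act_def fun_eq_iff)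
  next
    case (relator r u v)
    then obtain s t n where "s \<in> S" "t \<in> S" "m s t = enat n"
      "r = concat (replicate n [(s, True), (t, True)])" by (auto simp: coxeter_relators_def)
    then show ?thesis using relator rel rep by (auto simp: act_def fun_eq_iff)
  qed
  have "act x = act y" if "equivclp (pres_step S (coxeter_relators S m)) x y" for x y
    using that by (induction rule: equivclp_induct) (auto simp: step dest: step)
  then have "act (map (\<lambda>s. (s, True)) u) = act (map (\<lambda>s. (s, True)) v)"
    using ws wp_eq_iff by blast
  moreover have "act (map (\<lambda>s. (s, True)) w) = foldr \<rho> w" for w
    by (induction w) (auto simp: act_def)
  ultimately show ?thesis by simp
qed

end

subsection \<open>The order of a product of two generators\<close>

text \<open>After multiplication by \<open>2 * sin \<theta>\<close> the sum telescopes over a full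
  period of the cosine; \<open>n \<ge> 2\<close> ensures
  \<open>sin \<theta> \<noteq> 0\<close>.\<close>

lemma sum_sin_period:
  assumes n: "2 \<le> n"
  shows "(\<Sum>i<n. sin (\<phi> + 2 * real i * (pi / real n))) = 0"
proof -
  define \<theta> where "\<theta> = pi / real n"
  have th: "0 < \<theta>" "\<theta> < pi" using n by (auto simp: \<theta>_def field_simps)
  then have s: "sin \<theta> \<noteq> 0" using sin_gt_zero by force
  have tel: "2 * sin \<theta> * sin (\<phi> + 2 * real i * \<theta>) =
     - (cos (\<phi> - \<theta> + 2 * real (Suc i) * \<theta>) - cos (\<phi> - \<theta> + 2 * real i * \<theta>))" for i
  proof -
    have a: "\<phi> - \<theta> + 2 * real (Suc i) * \<theta> = (\<phi> + 2 * real i * \<theta>) + \<theta>" by (simp add: algebra_simps)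
    have b: "\<phi> - \<theta> + 2 * real i * \<theta> = (\<phi> + 2 * real i * \<theta>) - \<theta>" by (simp add: algebra_simps)
    show ?thesis unfolding a b cos_add cos_diff by (simp add: algebra_simps)
  qed
  have "2 * sin \<theta> * (\<Sum>i<n. sin (\<phi> + 2 * real i * \<theta>)) =
    (\<Sum>i<n. - (cos (\<phi> - \<theta> + 2 * real (Suc i) * \<theta>) - cos (\<phi> - \<theta> + 2 * real i * \<theta>)))"
    unfolding sum_distrib_left tel ..
  also have "\<dots> = - (cos (\<phi> - \<theta> + 2 * real n * \<theta>) - cos (\<phi> - \<theta> + 2 * real 0 * \<theta>))"
    unfolding sum_negf
    using sum_lessThan_telescope[of "\<lambda>i. cos (\<phi> - \<theta> + 2 * real i * \<theta>)" n] by simp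
  also have "2 * real n * \<theta> = 2 * pi" using n by (simp add: \<theta>_def)
  finally show ?thesis using s by (simp add: \<theta>_def)
qed

text \<open>
  The dual of the geometric representation: the generator \<open>s\<close> replaces \<open>f\<close> by
  \<open>\<lambda>u. f u - 2 B(s, u) f s\<close>, with \<open>B\<close> the standard bilinear form.
\<close>

definition geom_coeff :: "('s \<Rightarrow> 's \<Rightarrow> enat) \<Rightarrow> 's \<Rightarrow> 's \<Rightarrow> real" where
  "geom_coeff m s u = (if s = u then -2 else case m s u of enat n \<Rightarrow> 2 * cos (pi / real n) | \<infinity> \<Rightarrow> 2)"

definition geom :: "('s \<Rightarrow> 's \<Rightarrow> enat) \<Rightarrow> 's \<Rightarrow> ('s \<Rightarrow> real) \<Rightarrow> 's \<Rightarrow> real" where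
  "geom m s f = (\<lambda>u. f u + geom_coeff m s u * f s)"

text \<open>\<open>x\<close> records the values that get reflected: \<open>x (2 * i + 1)\<close> at
  \<open>t\<close> just before \<open>geom m t\<close> acts, \<open>x (2 * i + 2)\<close> at
  \<open>s\<close> just before \<open>geom m s\<close> acts. Acting flips the sign of the value,
  whence \<open>- x (2 * j)\<close>, and adds \<open>k\<close> times it at the other generator,
  whence the recurrence.\<close>

lemma geom_iterate:
  fixes x :: "nat \<Rightarrow> real"
  assumes st: "s \<noteq> t" and k: "geom_coeff m s t = k" "geom_coeff m t s = k"
    and x: "x 0 = - f s" "x 1 = f t" "\<And>i. x (i + 2) = k * x (i + 1) - x i"
  shows "((geom m s \<circ> geom m t) ^^ j) f =
      (\<lambda>u. f u + geom_coeff m t u * (\<Sum>i<j. x (2 * i + 1)) + geom_coeff m s u * (\<Sum>i<j. x (2 * i + 2)))"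
    and "((geom m s \<circ> geom m t) ^^ j) f s = - x (2 * j)"
    and "((geom m s \<circ> geom m t) ^^ j) f t = x (2 * j + 1)"
proof -
  let ?F = "\<lambda>j u. f u + geom_coeff m t u * (\<Sum>i<j. x (2 * i + 1)) + geom_coeff m s u * (\<Sum>i<j. x (2 * i + 2))"
  have kk: "geom_coeff m s s = -2" "geom_coeff m t t = -2" by (auto simp: geom_coeff_def)
  have s: "?F j s = - x (2 * j)" and t: "?F j t = x (2 * j + 1)" for j
  proof (induction j)
    case 0
    { case 1 show ?case using x by simp }
    { case 2 show ?case using x by simp }
  next
    case (Suc j)
    note r = x(3)[of "2 * j"] x(3)[of "2 * j + 1"]
    { case 1 show ?case using Suc r by (simp add: k kk algebra_simps numeral_eq_Suc) }
    { case 2 show ?case using Suc r by (simp add: k kk algebra_simps numeral_eq_Suc) }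
  qed
  show F: "((geom m s \<circ> geom m t) ^^ j) f = ?F j" for j
  proof (induction j)
    case (Suc j)
    have "((geom m s \<circ> geom m t) ^^ Suc j) f = geom m s (geom m t (?F j))"
      by (simp only: funpow.simps comp_apply Suc)
    also have "\<dots> = ?F (Suc j)"
    proof
      fix u
      have a: "geom m t (?F j) s = x (2 * j + 2)"
        unfolding geom_def using s[of j] t[of j] x(3)[of "2 * j"] by (simp add: k)
      have b: "geom m t (?F j) u = ?F j u + geom_coeff m t u * x (2 * j + 1)"
        unfolding geom_def t ..
      have "geom m s (geom m t (?F j)) u = geom m t (?F j) u + geom_coeff m s u * geom m t (?F j) s"
        by (simp only: geom_def)
      then show "geom m s (geom m t (?F j)) u = ?F (Suc j) u"
        unfolding a b by (simp add: algebra_simps)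
    qed
    finally show ?case .
  qed simp
  show "((geom m s \<circ> geom m t) ^^ j) f s = - x (2 * j)" using F s by simp
  show "((geom m s \<circ> geom m t) ^^ j) f t = x (2 * j + 1)" using F t by simp
qed

lemma sin_recurrence: "sin ((r + 2) * \<theta>) = 2 * cos \<theta> * sin ((r + 1) * \<theta>) - sin (r * (\<theta>::real))"
proof -
  have a: "(r + 2) * \<theta> = (r + 1) * \<theta> + \<theta>" "r * \<theta> = (r + 1) * \<theta> - \<theta>" by (simp_all add: algebra_simps)
  show ?thesis unfolding a sin_add sin_diff by simp
qed

text \<open>The values in \<open>geom_iterate\<close> are combinations of sines with phase step
  \<open>pi / n\<close>. Every second one advances the phase by \<open>2 * pi / n\<close>, so
  \<open>n\<close> of them cover a full period and both correction sums vanish.\<close>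

lemma geom_relation:
  assumes st: "s \<noteq> t" and m: "m s t = enat n" "m t s = enat n" and n: "2 \<le> n"
  shows "(geom m s \<circ> geom m t) ^^ n = id"
proof
  fix f :: "'a \<Rightarrow> real"
  define \<theta> where "\<theta> = pi / real n"
  have "0 < \<theta>" "\<theta> < pi" using n by (auto simp: \<theta>_def field_simps)
  then have sn: "sin \<theta> \<noteq> 0" using sin_gt_zero by force
  \<comment> \<open>The solution of the recurrence with initial values \<open>- f s\<close> and
    \<open>f t\<close>.\<close>
  define x where "x i = (f t * sin (real i * \<theta>) + f s * sin ((real i - 1) * \<theta>)) / sin \<theta>" for i
  have k: "geom_coeff m s t = 2 * cos \<theta>" "geom_coeff m t s = 2 * cos \<theta>"
    using st m by (auto simp: geom_coeff_def \<theta>_def)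
  have x: "x 0 = - f s" "x 1 = f t" using sn by (auto simp: x_def)
  have rec: "x (i + 2) = 2 * cos \<theta> * x (i + 1) - x i" for i
  proof -
    have "sin (real (i + 2) * \<theta>) = 2 * cos \<theta> * sin (real (i + 1) * \<theta>) - sin (real i * \<theta>)"
      using sin_recurrence[of "real i" \<theta>] by (simp add: algebra_simps)
    moreover have "sin ((real (i + 2) - 1) * \<theta>) = 2 * cos \<theta> * sin ((real (i + 1) - 1) * \<theta>) - sin ((real i - 1) * \<theta>)"
      using sin_recurrence[of "real i - 1" \<theta>] by (simp add: algebra_simps)
    ultimately show ?thesis unfolding x_def using sn by (simp add: divide_simps) (simp add: algebra_simps)
  qed
  have z: "(\<Sum>i<n. sin ((2 * real i + c) * \<theta>)) = 0" for c
    using sum_sin_period[OF n, of "c * \<theta>"] by (simp add: \<theta>_def[symmetric] algebra_simps)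
  have sums: "(\<Sum>i<n. x (2 * i + c)) = 0" for c
  proof -
    have "(\<Sum>i<n. x (2 * i + c)) = (f t * (\<Sum>i<n. sin ((2 * real i + real c) * \<theta>)) +
        f s * (\<Sum>i<n. sin ((2 * real i + (real c - 1)) * \<theta>))) / sin \<theta>"
      unfolding x_def sum_divide_distrib[symmetric] sum.distrib sum_distrib_left
      by (simp add: add_diff_eq)
    then show ?thesis unfolding z by simp
  qed
  show "((geom m s \<circ> geom m t) ^^ n) f = id f"
    unfolding geom_iterate(1)[OF st k x rec] sums by simp
qed

text \<open>Follow the indicator function of \<open>t\<close>. For a finite label, returning to it
  would force \<open>cos (2 * j * \<theta>) = 1\<close> although
  \<open>0 < j * \<theta> < pi\<close>; for an infinite label the recorded values grow
  linearly.\<close>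

lemma geom_order:
  assumes st: "s \<noteq> t" and m: "m s t = m t s" and j: "0 < j" "enat j < m s t" and two: "2 \<le> m s t"
  shows "(geom m s \<circ> geom m t) ^^ j \<noteq> id"
proof
  assume id: "(geom m s \<circ> geom m t) ^^ j = id"
  define f where "f = (\<lambda>u. if u = t then 1 else (0::real))"
  have fst: "f s = 0" "f t = 1" using st by (auto simp: f_def)
  show False
  proof (cases "m s t")
    case infinity
    then have k: "geom_coeff m s t = 2" "geom_coeff m t s = 2" using st m by (auto simp: geom_coeff_def)
    have "((geom m s \<circ> geom m t) ^^ j) f s = - real (2 * j)"
      by (rule geom_iterate(2)[OF st k, where x = real]) (auto simp: fst)
    then show False using id fst j by simp
  next
    case (enat n)
    define \<theta> where "\<theta> = pi / real n"
    have n: "2 \<le> n" "j < n" using enat two j by (auto simp: numeral_eq_enat)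
    then have th: "0 < \<theta>" "\<theta> < pi" by (auto simp: \<theta>_def field_simps)
    then have sn: "sin \<theta> > 0" using sin_gt_zero by force
    have k: "geom_coeff m s t = 2 * cos \<theta>" "geom_coeff m t s = 2 * cos \<theta>"
      using st by (simp_all add: geom_coeff_def \<theta>_def enat m[symmetric])
    define x where "x i = sin (real i * \<theta>) / sin \<theta>" for i
    have x: "x 0 = - f s" "x 1 = f t" using sn by (auto simp: x_def fst)
    have rec: "x (i + 2) = 2 * cos \<theta> * x (i + 1) - x i" for i
      using sin_recurrence[of "real i" \<theta>] sn by (simp add: x_def field_simps)
    have "x (2 * j) = 0" "x (2 * j + 1) = 1"
      using geom_iterate(2,3)[OF st k x rec, of j] id fst by auto
    then have s0: "sin (2 * real j * \<theta>) = 0" and s1: "sin (2 * real j * \<theta> + \<theta>) = sin \<theta>"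
      using sn by (auto simp: x_def field_simps)
    then have "cos (2 * real j * \<theta>) = 1" using sn by (simp add: sin_add)
    moreover have "0 < real j * \<theta>" "real j * \<theta> < pi"
      using n j th by (auto simp: \<theta>_def field_simps)
    then have "sin (real j * \<theta>) > 0" by (rule sin_gt_zero)
    moreover have "cos (2 * (real j * \<theta>)) = 1 - 2 * (sin (real j * \<theta>))\<^sup>2" by (rule cos_double_sin)
    ultimately show False by (simp add: mult.assoc)
  qed
qed

context coxeter_system
begin

lemma set_alt [simp]: "s \<in> S \<Longrightarrow> t \<in> S \<Longrightarrow> set (alt s t n) \<subseteq> S"
  using set_alt_subset[of s t n] by auto

lemma inv_cancel [simp]: "a \<in> carrier G \<Longrightarrow> g \<in> carrier G \<Longrightarrow> inv a \<otimes> (a \<otimes> g) = g"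
  and cancel_inv [simp]: "a \<in> carrier G \<Longrightarrow> g \<in> carrier G \<Longrightarrow> a \<otimes> (inv a \<otimes> g) = g"
  by (simp_all add: m_assoc[symmetric])

lemma wp_alt_double: "s \<in> S \<Longrightarrow> t \<in> S \<Longrightarrow> wp (alt s t (2 * n)) = (s \<otimes> t) [^] n"
proof (induction n)
  case (Suc n)
  then have "wp (alt s t (2 * Suc n)) = (s \<otimes> t) \<otimes> (s \<otimes> t) [^] n" by (simp add: S_sub m_assoc)
  then show ?case using Suc.prems nat_pow_Suc2[of "s \<otimes> t" n] by (simp add: S_sub)
qed simp

lemma foldr_alt_double: "foldr h (alt s t (2 * n)) = (h s \<circ> h t) ^^ n"
  by (induction n) (simp_all add: comp_assoc)

text \<open>A smaller power of \<open>s t\<close> equal to the identity would act trivially under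
  \<open>geom\<close>, against \<open>geom_order\<close>.\<close>

lemma alt_double_ne_one:
  assumes "s \<in> S" "t \<in> S" "s \<noteq> t" "0 < j" "enat j < m s t"
  shows "wp (alt s t (2 * j)) \<noteq> \<one>"
proof
  assume a: "wp (alt s t (2 * j)) = \<one>"
  have "foldr (geom m) (alt s t (2 * j)) = foldr (geom m) []"
  proof (rule presentation_action)
    fix x y n assume xy: "x \<in> S" "y \<in> S" "m x y = enat n"
    show "(geom m x \<circ> geom m y) ^^ n = id"
    proof (cases "x = y")
      case True
      then have "n = 1" using xy m_self by (simp add: one_enat_def)
      then show ?thesis using True by (auto simp: geom_def geom_coeff_def fun_eq_iff)
    next
      case False
      then show ?thesis using xy m_sym[of x y] m_ge_2[of x y] by (intro geom_relation) (auto simp: numeral_eq_enat)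
    qed
  qed (use a assms in auto)
  then show False
    unfolding foldr_alt_double using geom_order[of s t m j] assms m_sym[of s t] m_ge_2[of s t] by (simp add: id_def[symmetric] foldr_Nil)
qed

lemma braid_relation:
  assumes "s \<in> S" "t \<in> S" "m s t = enat n"
  shows "wp (alt s t n) = wp (alt t s n)"
proof -
  have "wp (rev (alt t s n) @ alt s t n) = \<one>"
    unfolding rev_alt_append using relation[of s t n] relation[of t s n] assms m_sym[of s t]
    by (simp add: mult_2)
  then have "inv (wp (alt t s n)) \<otimes> wp (alt s t n) = \<one>" using assms by (simp add: inv_wp)
  then show ?thesis using assms
    by (metis set_alt inv_closed inv_equality inv_inv wp_closed)
qed

subsection \<open>Reduced words\<close>

definition red :: "'a list \<Rightarrow> bool" where
  red_iff: "red ws \<longleftrightarrow> set ws \<subseteq> S \<and> length ws = ell (wp ws)"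

lemma reduced_expr_iff: "reduced_expr w ws \<longleftrightarrow> red ws \<and> wp ws = w"
  by (auto simp: reduced_expr_def red_iff lists_eq_set)

lemma ell_le: "set ws \<subseteq> S \<Longrightarrow> ell (wp ws) \<le> length ws"
  unfolding ell_def by (rule Least_le) (auto simp: lists_eq_set)

lemma reduced_exists: assumes "w \<in> carrier G" obtains ws where "red ws" "wp ws = w"
proof -
  have "\<exists>n. \<exists>ws\<in>lists S. length ws = n \<and> wp ws = w"
    using wp_surj[OF assms] by (auto simp: lists_eq_set)
  from LeastI_ex[OF this] obtain ws where "set ws \<subseteq> S" "length ws = ell w" "wp ws = w"
    unfolding ell_def by auto
  then show ?thesis using that by (simp add: red_iff)
qed

lemma red_append:
  assumes "red (u @ v)" shows "red u" "red v"
proof -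
  have l: "set u \<subseteq> S" "set v \<subseteq> S" using assms by (auto simp: red_iff)
  obtain u' where u': "red u'" "wp u' = wp u" using reduced_exists[of "wp u"] l by auto
  obtain v' where v': "red v'" "wp v' = wp v" using reduced_exists[of "wp v"] l by auto
  have "length u + length v = ell (wp (u @ v))" using assms by (simp add: red_iff)
  also have "\<dots> = ell (wp (u' @ v'))" using l u' v' by (simp add: red_iff)
  also have "\<dots> \<le> length u' + length v'" using ell_le[of "u' @ v'"] u' v' by (simp add: red_iff)
  finally have "length u + length v \<le> ell (wp u) + ell (wp v)" using u' v' by (simp add: red_iff)
  then show "red u" "red v" using ell_le[OF l(1)] ell_le[OF l(2)] l by (simp_all add: red_iff)
qed

lemma red_rev: assumes "red ws" shows "red (rev ws)"
proof -
  have ws: "set ws \<subseteq> S" using assms by (simp add: red_iff)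
  obtain us where us: "red us" "wp us = wp (rev ws)" using reduced_exists[of "wp (rev ws)"] ws by auto
  then have u: "set us \<subseteq> S" by (simp add: red_iff)
  have "wp (rev us) = inv (wp (rev ws))" using us inv_wp[OF u] by simp
  also have "\<dots> = wp ws" using inv_wp[of "rev ws"] ws by simp
  finally have "length ws \<le> length us" using ell_le[of "rev us"] u assms by (simp add: red_iff)
  then show ?thesis using us ell_le[of "rev ws"] ws by (simp add: red_iff)
qed

lemma red_Nil: "red []"
  using ell_le[of "[]"] by (simp add: red_iff)

subsection \<open>The exchange condition\<close>

text \<open>
  \<open>rfl (s\<^sub>1 \<dots> s\<^sub>n)\<close> lists the reflections \<open>g\<close> such that multiplying the product by \<open>g\<close> on the
  right deletes one letter. The parity with which a reflection occurs depends on the product only.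
\<close>

fun rfl :: "'a list \<Rightarrow> 'a list" where
  "rfl [] = []"
| "rfl (s # ws) = (inv (wp ws) \<otimes> s \<otimes> wp ws) # rfl ws"

text \<open>These are the alternating products of odd length ending in \<open>t\<close>, written as
  \<open>(t s)^j t\<close> with \<open>j\<close> falling from \<open>2 * n - 1\<close> to 0.\<close>

lemma rfl_alt_double:
  assumes st: "s \<in> S" "t \<in> S"
  shows "rfl (alt s t (2 * n)) = map (\<lambda>j. (t \<otimes> s) [^] j \<otimes> t) (rev [0..<2 * n])"
proof (induction n)
  case (Suc n)
  have c: "s \<in> carrier G" "t \<in> carrier G" "t \<otimes> s \<in> carrier G" using st S_sub by auto
  have i: "inv (s \<otimes> t) = t \<otimes> s" using st c by (simp add: inv_mult_group)
  let ?b = "t \<otimes> s"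
  have w: "wp (alt s t (2 * n)) = (s \<otimes> t) [^] n" using st by (rule wp_alt_double)
  have iw: "inv ((s \<otimes> t) [^] n) = ?b [^] n" using c i by (simp add: nat_pow_inv[symmetric])
  have comm: "t \<otimes> (s \<otimes> t) [^] n = ?b [^] n \<otimes> t" for n :: nat
  proof (induction n)
    case (Suc n)
    have "t \<otimes> (s \<otimes> t) [^] Suc n = (t \<otimes> (s \<otimes> t) [^] n) \<otimes> (s \<otimes> t)" using c by (simp add: m_assoc)
    also have "\<dots> = ?b [^] Suc n \<otimes> t" unfolding Suc using c by (simp add: m_assoc)
    finally show ?case .
  qed (use c in simp)
  have A: "?b [^] n \<otimes> t \<otimes> (s \<otimes> t) [^] n = ?b [^] (2 * n) \<otimes> t"
  proof -
    have "?b [^] n \<otimes> t \<otimes> (s \<otimes> t) [^] n = ?b [^] n \<otimes> (t \<otimes> (s \<otimes> t) [^] n)"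
      using c by (simp add: m_assoc)
    also have "\<dots> = ?b [^] n \<otimes> (?b [^] n \<otimes> t)" unfolding comm ..
    finally have "?b [^] n \<otimes> t \<otimes> (s \<otimes> t) [^] n = ?b [^] n \<otimes> (?b [^] n \<otimes> t)" .
    then show ?thesis using c by (simp add: m_assoc[symmetric] nat_pow_mult mult_2)
  qed
  have B: "inv (t \<otimes> (s \<otimes> t) [^] n) \<otimes> s \<otimes> (t \<otimes> (s \<otimes> t) [^] n) = ?b [^] Suc (2 * n) \<otimes> t"
  proof -
    have "inv (t \<otimes> (s \<otimes> t) [^] n) \<otimes> s \<otimes> (t \<otimes> (s \<otimes> t) [^] n) = ?b [^] n \<otimes> (t \<otimes> (s \<otimes> (?b [^] n \<otimes> t)))"
      unfolding comm[symmetric] using c st by (simp add: inv_mult_group iw m_assoc)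
    also have "\<dots> = (?b [^] n \<otimes> ?b) \<otimes> ?b [^] n \<otimes> t" using c by (simp add: m_assoc)
    also have "?b [^] n \<otimes> ?b = ?b [^] Suc n" by simp
    also have "?b [^] Suc n \<otimes> ?b [^] n = ?b [^] Suc (2 * n)" using c by (simp only: nat_pow_mult) (simp add: mult_2)
    finally show ?thesis .
  qed
  have "alt s t (2 * Suc n) = s # t # alt s t (2 * n)" by simp
  then show ?case using Suc A B by (simp add: w iw)
qed simp

text \<open>\<open>(t s)^n = 1\<close> makes the list of \<open>2 * n\<close> reflections run twice
  through the same \<open>n\<close> terms.\<close>

lemma even_count_rfl_relator:
  assumes st: "s \<in> S" "t \<in> S" "m s t = enat n"
  shows "even (count_list (rfl (alt s t (2 * n))) g)"
proof -
  let ?f = "\<lambda>j::nat. (t \<otimes> s) [^] j \<otimes> t"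
  have c: "s \<in> carrier G" "t \<in> carrier G" using st S_sub by auto
  have "wp (alt t s (2 * n)) = \<one>" using relation[of t s n] st m_sym[of s t] by simp
  then have "(t \<otimes> s) [^] n = \<one>" using wp_alt_double st by simp
  then have per: "?f (n + j) = ?f j" for j
    using c nat_pow_mult[of "t \<otimes> s" n j, symmetric] by simp
  have "map ?f [0..<2 * n] = map ?f [0..<n] @ map ?f [n..<n + n]"
    using upt_add_eq_append[of 0 n n] by (simp add: mult_2)
  also have "map ?f [n..<n + n] = map ?f [0..<n]"
    by (rule nth_equalityI) (auto simp: per)
  finally have "count_list (map ?f [0..<2 * n]) g = 2 * count_list (map ?f [0..<n]) g" by simp
  then show ?thesis unfolding rfl_alt_double[OF st(1,2)] rev_map[symmetric] by (simp add: count_list_rev)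
qed

text \<open>The action is the classical one on signed reflections: \<open>\<rho> s\<close>
  conjugates by \<open>s\<close> and flips the sign exactly at \<open>s\<close>. Along a word the
  flips count occurrences in \<open>rfl\<close>; evenness on relators makes the action well defined
  on the group.\<close>

lemma count_rfl_parity:
  assumes ws: "set u \<subseteq> S" "set v \<subseteq> S" "wp u = wp v" and g: "g \<in> carrier G"
  shows "odd (count_list (rfl u) g) \<longleftrightarrow> odd (count_list (rfl v) g)"
proof -
  \<comment> \<open>Outside the carrier \<open>\<rho> s\<close> is the identity, so that the
    relations hold as equations between functions on the whole type.\<close>
  define \<rho> where "\<rho> s = (\<lambda>(g, b). if g \<in> carrier G then (s \<otimes> g \<otimes> s, b \<noteq> (g = s)) else (g, b))" for s
  have fold: "foldr \<rho> w (g, b) = (wp w \<otimes> g \<otimes> inv (wp w), b \<noteq> odd (count_list (rfl w) g))"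
    if "set w \<subseteq> S" "g \<in> carrier G" for w g b
    using that
  proof (induction w)
    case (Cons s w)
    then have c: "s \<in> S" "s \<in> carrier G" "wp w \<in> carrier G" "set w \<subseteq> S" using S_sub by auto
    have eq: "wp w \<otimes> g \<otimes> inv (wp w) = s \<longleftrightarrow> inv (wp w) \<otimes> s \<otimes> wp w = g"
    proof
      assume "wp w \<otimes> g \<otimes> inv (wp w) = s"
      then show "inv (wp w) \<otimes> s \<otimes> wp w = g" using c Cons.prems by (auto simp: m_assoc inv_solve_left)
    next
      assume "inv (wp w) \<otimes> s \<otimes> wp w = g"
      then show "wp w \<otimes> g \<otimes> inv (wp w) = s"
        using c Cons.prems by (metis inv_closed inv_solve_left inv_solve_right m_assoc m_closed)
    qed
    have "foldr \<rho> (s # w) (g, b) = \<rho> s (wp w \<otimes> g \<otimes> inv (wp w), b \<noteq> odd (count_list (rfl w) g))"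
      using Cons by simp
    also have "\<dots> = (wp (s # w) \<otimes> g \<otimes> inv (wp (s # w)), b \<noteq> odd (count_list (rfl (s # w)) g))"
      using c Cons.prems by (auto simp: \<rho>_def inv_mult_group m_assoc eq)
    finally show ?case .
  qed simp
  have "foldr \<rho> u = foldr \<rho> v"
  proof (rule presentation_action[OF _ ws])
    fix s t n assume st: "s \<in> S" "t \<in> S" "m s t = enat n"
    have p: "(\<rho> s \<circ> \<rho> t) ^^ n = foldr \<rho> (alt s t (2 * n))"
      by (rule foldr_alt_double[symmetric])
    show "(\<rho> s \<circ> \<rho> t) ^^ n = id"
    proof
      fix z :: "'a \<times> bool"
      obtain h b where z: "z = (h, b)" by force
      show "((\<rho> s \<circ> \<rho> t) ^^ n) z = id z"
      proof (cases "h \<in> carrier G")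
        case True
        have a: "set (alt s t (2 * n)) \<subseteq> S" using st by simp
        show ?thesis unfolding p z fold[OF a True] relation[OF st]
          using True even_count_rfl_relator[OF st, of h] by simp
      next
        case False
        have "((\<rho> s \<circ> \<rho> t) ^^ k) z = z" for k by (induction k) (use False z in \<open>auto simp: \<rho>_def\<close>)
        then show ?thesis by simp
      qed
    qed
  qed
  then have "foldr \<rho> u (g, False) = foldr \<rho> v (g, False)" by simp
  then show ?thesis using fold ws g by auto
qed

definition del :: "nat \<Rightarrow> 'a list \<Rightarrow> 'a list" where
  "del i ws = take i ws @ drop (Suc i) ws"

lemma length_del: "i < length ws \<Longrightarrow> Suc (length (del i ws)) = length ws"
  by (simp add: del_def)

lemma set_del: "set ws \<subseteq> A \<Longrightarrow> set (del i ws) \<subseteq> A"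
  by (auto simp: del_def dest: in_set_takeD in_set_dropD)

lemma rfl_delete:
  assumes "set ws \<subseteq> S" "g \<in> set (rfl ws)"
  shows "\<exists>i<length ws. wp ws \<otimes> g = wp (del i ws)"
  using assms
proof (induction ws)
  case (Cons s ws)
  then have c: "s \<in> S" "s \<in> carrier G" "wp ws \<in> carrier G" "set ws \<subseteq> S" using S_sub by auto
  show ?case
  proof (cases "g \<in> set (rfl ws)")
    case True
    then obtain i where i: "i < length ws" "wp ws \<otimes> g = wp (del i ws)" using Cons c by blast
    have "g \<in> carrier G" using True c(4)
      by (induction ws) (auto simp: S_sub)
    then have "wp (s # ws) \<otimes> g = wp (del (Suc i) (s # ws))" using i c by (simp add: m_assoc del_def)
    then show ?thesis using i by auto
  next
    case False
    then have "g = inv (wp ws) \<otimes> s \<otimes> wp ws" using Cons.prems by auto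
    then have "wp (s # ws) \<otimes> g = wp (del 0 (s # ws))"
      using c by (simp add: del_def m_assoc)
    then show ?thesis by auto
  qed
qed simp

text \<open>Let \<open>g\<close> be the reflection with \<open>w g = s w\<close>. If it were absent
  from \<open>rfl ws\<close>, it would occur exactly once for \<open>s # ws\<close> and so, by
  parity, in a shortest word of \<open>s w\<close>. Deleting a letter there gives a word for
  \<open>w\<close>, so \<open>s w\<close> is longer than \<open>w\<close> and \<open>s # ws\<close>
  is reduced.\<close>

lemma exchange:
  assumes red: "red ws" and s: "s \<in> S" and nr: "\<not> red (s # ws)"
  shows "\<exists>i<length ws. s \<otimes> wp ws = wp (del i ws)"
proof -
  let ?w = "wp ws"
  have ws: "set ws \<subseteq> S" using red by (simp add: red_iff)
  then have c: "s \<in> carrier G" "?w \<in> carrier G" using s S_sub by auto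
  define g where "g = inv ?w \<otimes> s \<otimes> ?w"
  have g: "g \<in> carrier G" using c by (simp add: g_def)
  have wg: "?w \<otimes> g = s \<otimes> ?w" using c by (simp add: g_def m_assoc[symmetric])
  have "g \<in> set (rfl ws)"
  proof (rule ccontr)
    assume "g \<notin> set (rfl ws)"
    then have o: "odd (count_list (rfl (s # ws)) g)" by (simp add: g_def count_notin)
    obtain us where us: "red us" "wp us = s \<otimes> ?w" using reduced_exists[of "s \<otimes> ?w"] c by auto
    then have ul: "set us \<subseteq> S" by (simp add: red_iff)
    have "odd (count_list (rfl us) g)"
      using count_rfl_parity[of "s # ws" us g] o us g ws s ul by simp
    then have "g \<in> set (rfl us)" using count_notin by force
    then obtain i where i: "i < length us" "wp us \<otimes> g = wp (del i us)" using rfl_delete ul by blast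
    have "wp us \<otimes> g = ?w" using us wg c g s by (simp add: m_assoc)
    then have "ell ?w \<le> length (del i us)" using i ell_le[of "del i us"] set_del[OF ul] by simp
    then have "length ws < length us" using length_del[OF i(1)] red by (simp add: red_iff)
    then have "length (s # ws) \<le> ell (wp (s # ws))" using us by (simp add: red_iff)
    then have "red (s # ws)" using ell_le[of "s # ws"] ws s by (simp add: red_iff)
    with nr show False by simp
  qed
  then show ?thesis using rfl_delete[OF ws] wg by metis
qed

lemma left_descent_iff:
  assumes "red ws" "s \<in> S"
  shows "left_descent (wp ws) s \<longleftrightarrow> \<not> red (s # ws)"
proof
  assume "left_descent (wp ws) s"
  then have "ell (wp (s # ws)) < length ws" using assms by (simp add: left_descent_def red_iff)
  then show "\<not> red (s # ws)" by (simp add: red_iff)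
next
  assume "\<not> red (s # ws)"
  then obtain i where i: "i < length ws" "s \<otimes> wp ws = wp (del i ws)" using exchange assms by blast
  have "ell (s \<otimes> wp ws) \<le> length (del i ws)"
    unfolding i(2) using assms by (intro ell_le set_del) (simp add: red_iff)
  then have "ell (s \<otimes> wp ws) < ell (wp ws)" using length_del[OF i(1)] assms(1) by (simp add: red_iff)
  then show "left_descent (wp ws) s" using assms by (simp add: left_descent_def)
qed

lemma left_descent_word:
  assumes "red ws" "s \<in> S" "left_descent (wp ws) s"
  shows "\<exists>us. red (s # us) \<and> wp (s # us) = wp ws"
proof -
  have ws: "set ws \<subseteq> S" using assms by (simp add: red_iff)
  obtain i where i: "i < length ws" "s \<otimes> wp ws = wp (del i ws)"
    using exchange assms left_descent_iff by blast
  have "wp (s # del i ws) = wp ws" using i(2)[symmetric] assms ws by (simp add: S_sub)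
  moreover have "length (s # del i ws) = length ws" using length_del[OF i(1)] by simp
  moreover have "set (s # del i ws) \<subseteq> S" using ws assms(2) set_del by simp
  ultimately show ?thesis using assms(1) unfolding red_iff by metis
qed

subsection \<open>Cosets of rank two parabolic subgroups\<close>

text \<open>
  If \<open>v\<close> is shortest in its coset, exchange can only delete letters from the dihedral part of
  \<open>b v\<close>; hence \<open>b v\<close> is reduced as soon as no shorter word represents \<open>b\<close>.
\<close>

lemma coset_min_reduced:
  assumes st: "s \<in> S" "t \<in> S" and vs: "red vs"
    and min: "\<And>b. set b \<subseteq> {s, t} \<Longrightarrow> length vs \<le> ell (wp b \<otimes> wp vs)"
    and b: "set b \<subseteq> {s, t}" "\<not> red (b @ vs)"
  shows "\<exists>b'. set b' \<subseteq> {s, t} \<and> length b' < length b \<and> even (length b + length b') \<and> wp b' = wp b"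
  using b
proof (induction b)
  case Nil then show ?case using vs by simp
next
  case (Cons x b)
  have sub: "\<And>c. set c \<subseteq> {s, t} \<Longrightarrow> set c \<subseteq> S" using st by auto
  have x: "x \<in> S" "x \<in> {s, t}" and b: "set b \<subseteq> {s, t}" "set b \<subseteq> S" using Cons.prems st by auto
  have vl: "set vs \<subseteq> S" using vs by (simp add: red_iff)
  show ?case
  proof (cases "red (b @ vs)")
    case False
    then obtain b' where "set b' \<subseteq> {s, t}" "length b' < length b" "even (length b + length b')" "wp b' = wp b"
      using Cons b by blast
    then show ?thesis using x by (intro exI[of _ "x # b'"]) auto
  next
    case True
    obtain i where i: "i < length (b @ vs)" "x \<otimes> wp (b @ vs) = wp (del i (b @ vs))"
      using exchange[OF True x(1)] Cons.prems by auto
    show ?thesis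
    proof (cases "i < length b")
      case True
      have d: "del i (b @ vs) = del i b @ vs" using True by (simp add: del_def)
      have db: "set (del i b) \<subseteq> {s, t}" using b(1) by (rule set_del)
      have "wp (x # b) \<otimes> wp vs = wp (del i b) \<otimes> wp vs"
        using i(2) unfolding d using x b vl sub[OF db] by (simp add: S_sub m_assoc)
      then have "wp (x # b) = wp (del i b)" using x b vl sub[OF db] by (simp add: S_sub)
      moreover have "length (x # b) + length (del i b) = 2 * length b" "length (del i b) < length (x # b)"
        using length_del[OF True] by auto
      ultimately show ?thesis using db by (metis dvd_triv_left)
    next
      case False
      define k where "k = i - length b"
      have k: "k < length vs" using False i by (simp add: k_def)
      have d: "del i (b @ vs) = b @ del k vs" using False by (simp add: del_def k_def Suc_diff_le)
      have dl: "set (del k vs) \<subseteq> S" using vl by (rule set_del)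
      have "x \<otimes> (wp b \<otimes> wp vs) = wp b \<otimes> wp (del k vs)" using i(2) unfolding d using b vl dl by simp
      then have "inv (wp b) \<otimes> (x \<otimes> (wp b \<otimes> wp vs)) = wp (del k vs)"
        using b dl by (simp add: m_assoc[symmetric])
      then have "wp (rev b @ x # b) \<otimes> wp vs = wp (del k vs)"
        using b vl x by (simp add: inv_wp m_assoc S_sub)
      moreover have "set (rev b @ x # b) \<subseteq> {s, t}" using x b by auto
      ultimately have "length vs \<le> ell (wp (del k vs))" using min by metis
      also have "\<dots> \<le> length (del k vs)" using dl by (rule ell_le)
      finally show ?thesis using length_del[OF k] by simp
    qed
  qed
qed

text \<open>A prepended letter either cancels the first letter or extends the alternation, so parity
  is preserved.\<close>

lemma dihedral_normal_form:
  assumes st: "s \<in> S" "t \<in> S"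
  shows "set b \<subseteq> {s, t} \<Longrightarrow>
    \<exists>x y k. (x, y) \<in> {(s, t), (t, s)} \<and> k \<le> length b \<and> even (k + length b) \<and> wp b = wp (alt x y k)"
proof (induction b)
  case Nil
  show ?case by (rule exI[of _ s], rule exI[of _ t], rule exI[of _ 0]) simp
next
  case (Cons a b)
  then obtain x y k where k: "(x, y) \<in> {(s, t), (t, s)}" "k \<le> length b" "even (k + length b)"
    "wp b = wp (alt x y k)" by auto
  have a: "a \<in> {s, t}" using Cons by simp
  have xy: "x \<in> S" "y \<in> S" "a = x \<or> a = y" using k st a by auto
  show ?case
  proof (cases "k = 0")
    case True
    obtain z where "(a, z) \<in> {(s, t), (t, s)}" using a by auto
    then show ?thesis using k True
      by (intro exI[of _ a] exI[of _ z] exI[of _ 1]) auto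
  next
    case False
    then obtain j where j: "k = Suc j" by (cases k) auto
    show ?thesis
    proof (cases "a = x")
      case True
      have "wp (a # b) = wp (alt y x j)" using k j True xy by simp
      then show ?thesis using k j by (intro exI[of _ y] exI[of _ x] exI[of _ j]) auto
    next
      case False
      then have "wp (a # b) = wp (alt y x (Suc k))" using k xy by simp
      then show ?thesis using k by (intro exI[of _ y] exI[of _ x] exI[of _ "Suc k"]) auto
    qed
  qed
qed

text \<open>By equal parity, the quotient of the two words in normal form is an alternating word of
  even length \<open>2 * j\<close> with \<open>0 < j < m s t\<close>, which is not the
  identity.\<close>

lemma alt_shortest:
  assumes st: "s \<in> S" "t \<in> S" "s \<noteq> t" and n: "enat n \<le> m s t"
    and b: "set b \<subseteq> {s, t}" "length b < n" "even (n + length b)"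
  shows "wp b \<noteq> wp (alt s t n)"
proof
  assume eq: "wp b = wp (alt s t n)"
  obtain x y k where k: "(x, y) \<in> {(s, t), (t, s)}" "k \<le> length b" "even (k + length b)" "wp b = wp (alt x y k)"
    using dihedral_normal_form[OF st(1,2) b(1)] by blast
  have kn: "k < n" "even (k + n)" using k b by auto
  have xy: "x \<in> S" "y \<in> S" "x \<noteq> y" using k st by auto
  have lt: "enat j < m p q" if "j < n" "(p, q) \<in> {(s, t), (t, s)}" for j p q
    using that n m_sym[OF st(1,2)] by (auto intro: less_le_trans[of _ "enat n"])
  have one: "wp (rev (alt x y k)) \<otimes> wp (alt s t n) = \<one>"
    using eq k(4) xy st by (simp add: inv_wp[symmetric])
  show False
  proof (cases "(x, y) = (s, t)")
    case True
    have "even (n - k)" using kn by auto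
    then obtain j where "n - k = 2 * j" by blast
    with kn(1) have j: "n = k + 2 * j" "0 < j" by auto
    define p q where "p = (if even k then s else t)" and "q = (if even k then t else s)"
    have "alt s t n = alt s t k @ alt p q (2 * j)" unfolding j(1) alt_add by (simp add: p_def q_def)
    then have "wp (rev (alt x y k)) \<otimes> (wp (alt s t k) \<otimes> wp (alt p q (2 * j))) = \<one>"
      using one st by (simp add: p_def q_def)
    then have "wp (alt p q (2 * j)) = \<one>"
      using True st by (simp add: inv_wp[symmetric] m_assoc[symmetric] p_def q_def)
    then show False
      using alt_double_ne_one[of p q j] st j lt[of j p q] by (auto simp: p_def q_def split: if_splits)
  next
    case False
    then have ts: "x = t" "y = s" using k by auto
    obtain j where j: "k + n = 2 * j" using kn(2) by (rule evenE)
    define p q where "p = (if even k then s else t)" and "q = (if even k then t else s)"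
    have "rev (alt x y k) @ alt s t n = alt p q (2 * j)"
      unfolding ts rev_alt_append j by (simp add: p_def q_def)
    then have "wp (alt p q (2 * j)) = \<one>" using one xy st by (metis wp_append set_alt set_rev)
    then show False
      using alt_double_ne_one[of p q j] st j kn lt[of j p q] by (auto simp: p_def q_def split: if_splits)
  qed
qed

text \<open>Take \<open>v\<close> shortest in the coset and \<open>b\<close> a shortest dihedral
  word with \<open>w = b v\<close>; were the normal form of \<open>b\<close> followed by
  \<open>vs\<close> not reduced, \<open>coset_min_reduced\<close> would give a shorter choice of
  \<open>b\<close>.\<close>

lemma coset_decomposition:
  assumes st: "s \<in> S" "t \<in> S" and w: "w \<in> carrier G"
  obtains x y k vs where "(x, y) \<in> {(s, t), (t, s)}" "red (alt x y k @ vs)" "wp (alt x y k @ vs) = w"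
    "red vs" "\<And>b. set b \<subseteq> {s, t} \<Longrightarrow> length vs \<le> ell (wp b \<otimes> wp vs)"
proof -
  have sub: "\<And>c. set c \<subseteq> {s, t} \<Longrightarrow> set c \<subseteq> S" using st by auto
  let ?C = "\<lambda>v. \<exists>b. set b \<subseteq> {s, t} \<and> v = wp b \<otimes> w"
  have "?C w" using w by (intro exI[of _ "[]"]) auto
  from ex_has_least_nat[of ?C, OF this, of ell]
  obtain v where v: "?C v" "\<And>u. ?C u \<Longrightarrow> ell v \<le> ell u" by blast
  obtain a where a: "set a \<subseteq> {s, t}" "v = wp a \<otimes> w" using v by blast
  have vc: "v \<in> carrier G" using a sub w by simp
  obtain vs where vs: "red vs" "wp vs = v" using reduced_exists[OF vc] by blast
  then have vl: "set vs \<subseteq> S" by (simp add: red_iff)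
  have min: "length vs \<le> ell (wp b \<otimes> wp vs)" if "set b \<subseteq> {s, t}" for b
  proof -
    have "wp b \<otimes> wp vs = wp (b @ a) \<otimes> w" using that sub a w vs by (simp add: m_assoc)
    moreover have "set (b @ a) \<subseteq> {s, t}" using that a by auto
    ultimately have "?C (wp b \<otimes> wp vs)" by blast
    then show ?thesis using v(2) vs by (simp add: red_iff)
  qed
  let ?D = "\<lambda>b. set b \<subseteq> {s, t} \<and> w = wp b \<otimes> v"
  have "?D (rev a)" using a w sub[OF a(1)] by (auto simp: inv_wp[symmetric] m_assoc[symmetric] simp del: inv_wp)
  from ex_has_least_nat[of ?D, OF this, of length]
  obtain b where b: "?D b" "\<And>c. ?D c \<Longrightarrow> length b \<le> length c" by blast
  obtain x y k where k: "(x, y) \<in> {(s, t), (t, s)}" "k \<le> length b" "wp b = wp (alt x y k)"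
    using dihedral_normal_form[OF st, of b] b by blast
  have alt: "set (alt x y k) \<subseteq> {s, t}" using set_alt_subset[of x y k] k(1) by auto
  have red: "red (alt x y k @ vs)"
  proof (rule ccontr)
    assume "\<not> ?thesis"
    then obtain b' where "set b' \<subseteq> {s, t}" "length b' < length (alt x y k)" "wp b' = wp (alt x y k)"
      using coset_min_reduced[OF st vs(1) min alt] by blast
    then show False using b(2)[of b'] b(1) k by simp
  qed
  have "wp (alt x y k @ vs) = w" using b(1) k(3) sub[OF alt] vl vs(2) by simp
  from that[OF k(1) red this vs(1) min] show ?thesis .
qed

lemma alt_reduced:
  assumes st: "s \<in> S" "t \<in> S" "s \<noteq> t" and n: "enat n \<le> m s t" and vs: "red vs"
    and min: "\<And>b. set b \<subseteq> {s, t} \<Longrightarrow> length vs \<le> ell (wp b \<otimes> wp vs)"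
  shows "red (alt s t n @ vs)"
proof (rule ccontr)
  assume "\<not> ?thesis"
  moreover have "set (alt s t n) \<subseteq> {s, t}" using set_alt_subset[of s t n] by auto
  ultimately obtain b' where "set b' \<subseteq> {s, t}" "length b' < n" "even (n + length b')" "wp b' = wp (alt s t n)"
    using coset_min_reduced[OF st(1,2) vs min, of "alt s t n"] by auto
  then show False using alt_shortest[OF st n] by blast
qed

text \<open>A nonempty dihedral prefix in the coset decomposition would begin with a descent, so an
  element without descents in \<open>{s, t}\<close> is itself shortest in its coset.\<close>

lemma no_descents_alt_reduced:
  assumes st: "s \<in> S" "t \<in> S" "s \<noteq> t" and n: "enat n \<le> m s t" and vs: "red vs"
    and d: "\<not> left_descent (wp vs) s" "\<not> left_descent (wp vs) t"
  shows "red (alt s t n @ vs)"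
proof -
  have "wp vs \<in> carrier G" using vs by (simp add: red_iff)
  then obtain x y k us where k: "(x, y) \<in> {(s, t), (t, s)}" "red (alt x y k @ us)" "wp (alt x y k @ us) = wp vs"
    "red us" "\<And>b. set b \<subseteq> {s, t} \<Longrightarrow> length us \<le> ell (wp b \<otimes> wp us)"
    by (rule coset_decomposition[OF st(1,2)]) (rule that)
  have xy: "x \<in> S" "y \<in> S" using k st by auto
  have "k = 0"
  proof (rule ccontr)
    assume "k \<noteq> 0"
    then obtain j where j: "k = Suc j" by (cases k) auto
    have ul: "set us \<subseteq> S" using k by (simp add: red_iff)
    have "x \<otimes> wp (alt x y k @ us) = wp (alt y x j @ us)" using j xy ul by (simp add: S_sub m_assoc)
    then have "ell (x \<otimes> wp vs) \<le> j + length us" using k(3) ell_le[of "alt y x j @ us"] xy ul by simp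
    also have "length (alt x y k @ us) = ell (wp vs)" using k(2) unfolding red_iff k(3) by blast
    then have "j + length us < ell (wp vs)" using j by simp
    finally have "left_descent (wp vs) x" using xy by (simp add: left_descent_def)
    then show False using k(1) d by auto
  qed
  then have "wp us = wp vs" using k by simp
  then show ?thesis using alt_reduced[OF st n vs] k(4,5) vs by (simp add: red_iff)
qed

text \<open>If the dihedral prefix had fewer than \<open>m s t\<close> letters, prepending the other
  generator would give a reduced word and that generator would be no descent. So the prefix contains
  a full braid, which can be rewritten to start with either generator.\<close>

lemma two_descents_braid:
  assumes st: "s \<in> S" "t \<in> S" "s \<noteq> t" and w: "w \<in> carrier G"
    and d: "left_descent w s" "left_descent w t"
  obtains n vs where "m s t = enat n" "red (alt s t n @ vs)" "wp (alt s t n @ vs) = w"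
    "red (alt t s n @ vs)" "wp (alt t s n @ vs) = w"
proof -
  obtain x y k vs where k: "(x, y) \<in> {(s, t), (t, s)}" "red (alt x y k @ vs)" "wp (alt x y k @ vs) = w"
    "red vs" "\<And>b. set b \<subseteq> {s, t} \<Longrightarrow> length vs \<le> ell (wp b \<otimes> wp vs)"
    by (rule coset_decomposition[OF st(1,2) w]) (rule that)
  have xy: "x \<in> S" "y \<in> S" "x \<noteq> y" "{x, y} = {s, t}" using k st by auto
  have yx: "y \<in> S" "x \<in> S" "y \<noteq> x" "{y, x} = {s, t}" using xy by auto
  have vl: "set vs \<subseteq> S" using k by (simp add: red_iff)
  have mm: "m y x = m s t" "m x y = m s t" using k(1) m_sym st by auto
  have "\<not> enat (Suc k) \<le> m s t"
  proof
    assume "enat (Suc k) \<le> m s t"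
    then have "red (alt y x (Suc k) @ vs)"
      by (intro alt_reduced[OF yx(1-3) _ k(4)]) (use k(5) mm yx(4) in auto)
    then have "red (y # (alt x y k @ vs))" by simp
    then have "\<not> left_descent w y" using left_descent_iff[OF k(2) yx(1)] k(3) by simp
    then show False using d k(1) by auto
  qed
  then obtain n where n: "m s t = enat n" "n \<le> k" by (cases "m s t") auto
  define r where "r = (if even n then alt x y (k - n) else alt y x (k - n)) @ vs"
  have r: "alt x y k @ vs = alt x y n @ r" using alt_add[of x y n "k - n"] n by (simp add: r_def)
  have rl: "set r \<subseteq> S" using vl xy by (simp add: r_def)
  have eq: "wp (alt y x n @ r) = wp (alt x y n @ r)"
    using braid_relation[of x y n] xy mm n rl by simp
  have r1: "red (alt x y n @ r)" "wp (alt x y n @ r) = w" using k(2,3) r by auto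
  have r2: "red (alt y x n @ r)" "wp (alt y x n @ r) = w"
    using r1 eq xy rl by (simp_all add: red_iff)
  show ?thesis using that[OF n(1), of r] r1 r2 k(1) by auto
qed

subsection \<open>Braid moves\<close>

inductive braid :: "'a list \<Rightarrow> 'a list \<Rightarrow> bool" where
  "s \<in> S \<Longrightarrow> t \<in> S \<Longrightarrow> s \<noteq> t \<Longrightarrow> m s t = enat n \<Longrightarrow> braid (u @ alt s t n @ v) (u @ alt t s n @ v)"

lemma braid_Cons:
  assumes "braid u v" shows "braid (a # u) (a # v)"
  using assms
proof cases
  case (1 s t n p q)
  then show ?thesis using braid.intros[of s t n "a # p" q] by simp
qed

lemma braid_star_Cons: "braid\<^sup>*\<^sup>* u v \<Longrightarrow> braid\<^sup>*\<^sup>* (a # u) (a # v)"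
  by (induction rule: rtranclp_induct) (auto intro: rtranclp.rtrancl_into_rtrancl braid_Cons)

text \<open>Equal first letters reduce to shorter words. Different first letters are both descents,
  so the element has reduced words starting with the two sides of one braid relation; these share a
  first letter with \<open>u\<close> and \<open>v\<close> respectively and differ by a single
  move.\<close>

lemma matsumoto: "red u \<Longrightarrow> red v \<Longrightarrow> wp u = wp v \<Longrightarrow> braid\<^sup>*\<^sup>* u v"
proof (induction "length u" arbitrary: u v)
  case 0
  then show ?case by (simp add: red_iff)
next
  case (Suc l)
  have len: "length v = Suc l" using Suc by (simp add: red_iff)
  obtain s u' where u: "u = s # u'" using Suc by (cases u) auto
  obtain t v' where v: "v = t # v'" using len by (cases v) auto
  have S: "s \<in> S" "t \<in> S" "set u' \<subseteq> S" "set v' \<subseteq> S" using Suc u v by (auto simp: red_iff)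
  have ru: "red u'" and rv: "red v'" using Suc u v red_append(2)[of "[s]" u'] red_append(2)[of "[t]" v'] by auto
  have same: "braid\<^sup>*\<^sup>* (a # p) (a # q)" if "red (a # p)" "red (a # q)" "wp (a # p) = wp (a # q)" "length p = l" for a p q
  proof -
    have "red p" "red q" using red_append(2)[of "[a]"] that by auto
    moreover have "wp p = wp q" using that by (simp add: red_iff S_sub)
    ultimately show ?thesis using Suc.hyps(1) that(4) by (intro braid_star_Cons) auto
  qed
  show ?case
  proof (cases "s = t")
    case True
    then show ?thesis using same Suc u v by auto
  next
    case False
    let ?w = "wp u"
    have w: "?w \<in> carrier G" using Suc by (simp add: red_iff)
    have ds: "left_descent (wp (a # p)) a" if "red (a # p)" for a p
    proof -
      have "a \<in> S" "set p \<subseteq> S" using that by (auto simp: red_iff)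
      then have "ell (a \<otimes> wp (a # p)) \<le> length p" using ell_le[of p] by simp
      then show ?thesis using that \<open>a \<in> S\<close> by (simp add: left_descent_def red_iff)
    qed
    have "left_descent ?w s" "left_descent ?w t" using ds[of s u'] ds[of t v'] Suc u v by auto
    then obtain n r where n: "m s t = enat n" "red (alt s t n @ r)" "wp (alt s t n @ r) = ?w"
      "red (alt t s n @ r)" "wp (alt t s n @ r) = ?w"
      using two_descents_braid[OF S(1,2) False w] by metis
    have "2 \<le> n" using m_ge_2[OF S(1,2) False] n(1) by (simp add: numeral_eq_enat)
    then obtain k where k: "n = Suc k" by (cases n) auto
    have "length (alt s t n @ r) = Suc l" using n(2,3) Suc by (simp add: red_iff)
    then have "braid\<^sup>*\<^sup>* u (alt s t n @ r)"
      unfolding u k using Suc n u k by (simp del: wp_Cons) (intro same, auto simp del: wp_Cons)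
    also have "braid (alt s t n @ r) (alt t s n @ r)"
      using braid.intros[OF S(1,2) False n(1), of "[]" r] by simp
    also have "braid\<^sup>*\<^sup>* (alt t s n @ r) v"
      unfolding v k
      using Suc n v k len \<open>length (alt s t n @ r) = Suc l\<close> by (simp del: wp_Cons) (intro same, auto simp del: wp_Cons)
    finally show ?thesis .
  qed
qed

end

context coxeter_system
begin

abbreviation adj :: "'a \<Rightarrow> 'a \<Rightarrow> bool" where "adj \<equiv> coxeter_adj S m"

lemma adj_sym: "adj s t \<Longrightarrow> adj t s"
  using m_sym by (auto simp: coxeter_adj_def)

text \<open>Commuting generators satisfy \<open>(s t)^2 = 1\<close>, so \<open>m s t\<close> cannot
  exceed 2. This ties commutation classes, defined by equations in the group, to the graph.\<close>

lemma commute_iff_not_adj: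
  assumes st: "s \<in> S" "t \<in> S" "s \<noteq> t"
  shows "s \<otimes> t = t \<otimes> s \<longleftrightarrow> \<not> adj s t"
proof
  assume c: "s \<otimes> t = t \<otimes> s"
  have "wp (alt s t (2 * 2)) = \<one>"
    using st c S_sub by (simp add: numeral_eq_Suc m_assoc[symmetric])
  then have "\<not> enat 2 < m s t" using alt_double_ne_one[OF st, of 2] by auto
  then show "\<not> adj s t"
    by (cases "m s t") (auto simp: coxeter_adj_def numeral_eq_enat)
next
  assume "\<not> adj s t"
  then have "m s t = enat 2" using st m_ge_2[OF st]
    by (cases "m s t") (auto simp: coxeter_adj_def numeral_eq_enat)
  then have "wp (alt s t 2) = wp (alt t s 2)" using braid_relation st by blast
  then show "s \<otimes> t = t \<otimes> s" using st S_sub by (simp add: numeral_eq_Suc)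
qed

subsection \<open>Commutation classes\<close>

lemma comm_swap_sym: "comm_swap u v \<Longrightarrow> comm_swap v u"
  by (erule comm_swap.cases) (metis comm_swap.intros)

lemma comm_star_sym: "comm_swap\<^sup>*\<^sup>* u v \<Longrightarrow> comm_swap\<^sup>*\<^sup>* v u"
  by (induction rule: rtranclp_induct) (auto intro: converse_rtranclp_into_rtranclp comm_swap_sym)

lemma comm_swap_context:
  assumes "comm_swap u v" shows "comm_swap (a @ u @ b) (a @ v @ b)"
  using assms
proof cases
  case (1 s t p q)
  then show ?thesis using comm_swap.intros[of s t "a @ p" "q @ b"] by simp
qed

lemma comm_star_context: "comm_swap\<^sup>*\<^sup>* u v \<Longrightarrow> comm_swap\<^sup>*\<^sup>* (a @ u @ b) (a @ v @ b)"
  by (induction rule: rtranclp_induct) (auto intro: rtranclp.rtrancl_into_rtrancl comm_swap_context)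

lemma comm_star_Cons: "comm_swap\<^sup>*\<^sup>* u v \<Longrightarrow> comm_swap\<^sup>*\<^sup>* (a # u) (a # v)"
  using comm_star_context[of u v "[a]" "[]"] by simp

lemma comm_swap_rev:
  assumes "comm_swap u v" shows "comm_swap (rev u) (rev v)"
  using assms
proof cases
  case (1 s t p q)
  then show ?thesis using comm_swap.intros[of t s "rev q" "rev p"] by simp
qed

lemma comm_star_rev: "comm_swap\<^sup>*\<^sup>* u v \<Longrightarrow> comm_swap\<^sup>*\<^sup>* (rev u) (rev v)"
  by (induction rule: rtranclp_induct) (auto intro: rtranclp.rtrancl_into_rtrancl comm_swap_rev)

lemma comm_star_mset: "comm_swap\<^sup>*\<^sup>* u v \<Longrightarrow> mset u = mset v"
  by (induction rule: rtranclp_induct) (auto elim!: comm_swap.cases)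

lemma comm_star_set: "comm_swap\<^sup>*\<^sup>* u v \<Longrightarrow> set u = set v"
  by (drule comm_star_mset) (rule mset_eq_setD)

lemma comm_star_distinct: "comm_swap\<^sup>*\<^sup>* u v \<Longrightarrow> distinct u \<Longrightarrow> distinct v"
  by (drule comm_star_mset) (metis mset_eq_imp_distinct_iff)

lemma comm_swap_wp:
  assumes "comm_swap u v" "set u \<subseteq> S" shows "wp u = wp v"
  using assms
proof cases
  case (1 s t p q)
  then have "s \<otimes> (t \<otimes> wp q) = t \<otimes> (s \<otimes> wp q)" if "set q \<subseteq> S"
    using that S_sub by (simp add: m_assoc[symmetric])
  then show ?thesis using 1 assms(2) by simp
qed

lemma comm_star_wp: "comm_swap\<^sup>*\<^sup>* u v \<Longrightarrow> set u \<subseteq> S \<Longrightarrow> wp u = wp v"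
proof (induction rule: rtranclp_induct)
  case (step y z)
  then show ?case using comm_swap_wp[of y z] comm_star_set[of u y] by simp
qed simp

text \<open>Combinatorial form of being a reduced word of a fully commutative element.\<close>

definition good :: "'a list \<Rightarrow> bool" where
  "good ws \<longleftrightarrow> set ws \<subseteq> S \<and> (\<forall>us p q. comm_swap\<^sup>*\<^sup>* ws us \<longrightarrow>
     (\<forall>s. us \<noteq> p @ [s, s] @ q) \<and>
     (\<forall>s t n. m s t = enat n \<longrightarrow> 3 \<le> n \<longrightarrow> us \<noteq> p @ alt s t n @ q))"

lemma good_S: "good ws \<Longrightarrow> set ws \<subseteq> S"
  by (simp add: good_def)

lemma good_no_square: "good ws \<Longrightarrow> comm_swap\<^sup>*\<^sup>* ws (p @ [s, s] @ q) \<Longrightarrow> False"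
  unfolding good_def by blast

lemma good_no_braid: "good ws \<Longrightarrow> m s t = enat n \<Longrightarrow> 3 \<le> n \<Longrightarrow> comm_swap\<^sup>*\<^sup>* ws (p @ alt s t n @ q) \<Longrightarrow> False"
  unfolding good_def by blast

lemma good_comm: "good ws \<Longrightarrow> comm_swap\<^sup>*\<^sup>* ws us \<Longrightarrow> good us"
  unfolding good_def using comm_star_set rtranclp_trans by metis

lemma good_Cons: assumes "good (a # ws)" shows "good ws"
  unfolding good_def
proof (intro conjI allI impI)
  show "set ws \<subseteq> S" using good_S[OF assms] by simp
next
  fix us p q s assume "comm_swap\<^sup>*\<^sup>* ws us"
  then have "comm_swap\<^sup>*\<^sup>* (a # ws) (a # us)" by (rule comm_star_Cons)
  then show "us \<noteq> p @ [s, s] @ q" using good_no_square[OF assms, of "a # p" s q] by auto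
next
  fix us p q s t n assume "comm_swap\<^sup>*\<^sup>* ws us" and n: "m s t = enat n" "3 \<le> n"
  then have "comm_swap\<^sup>*\<^sup>* (a # ws) (a # us)" by (intro comm_star_Cons)
  then show "us \<noteq> p @ alt s t n @ q" using good_no_braid[OF assms n, of "a # p" q] by auto
qed

lemma alt_letters: "2 \<le> n \<Longrightarrow> set (alt s t n) = {s, t}"
  by (cases n; cases "n - 1") (use set_alt_subset in force)+

lemma good_rev: assumes "good ws" shows "good (rev ws)"
  unfolding good_def
proof (intro conjI allI impI)
  show "set (rev ws) \<subseteq> S" using good_S[OF assms] by simp
next
  fix us p q s assume "comm_swap\<^sup>*\<^sup>* (rev ws) us"
  then have "comm_swap\<^sup>*\<^sup>* ws (rev us)" using comm_star_rev by fastforce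
  then show "us \<noteq> p @ [s, s] @ q" using good_no_square[OF assms, of "rev q" s "rev p"] by auto
next
  fix us p q s t n assume us: "comm_swap\<^sup>*\<^sup>* (rev ws) us" and n: "m s t = enat n" "3 \<le> n"
  show "us \<noteq> p @ alt s t n @ q"
  proof
    assume eq: "us = p @ alt s t n @ q"
    have c: "comm_swap\<^sup>*\<^sup>* ws (rev q @ rev (alt s t n) @ rev p)"
      using comm_star_rev[OF us] eq by simp
    have "set us \<subseteq> S" using comm_star_set[OF us] good_S[OF assms] by simp
    then have "s \<in> S" "t \<in> S" using eq alt_letters[of n s t] n by auto
    then have "m t s = enat n" using m_sym n by simp
    then show False
      using c good_no_braid[OF assms n, of "rev q" "rev p"] good_no_braid[OF assms _ n(2), of t s "rev q" "rev p"]
      unfolding rev_alt by (auto split: if_splits)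
  qed
qed

text \<open>A braid with three or more letters never applies in the class of a good word, so every
  braid move is a commutation.\<close>

lemma good_braid: assumes "braid\<^sup>*\<^sup>* ws us" "good ws" shows "comm_swap\<^sup>*\<^sup>* ws us"
  using assms
proof (induction rule: rtranclp_induct)
  case (step y z)
  then have y: "comm_swap\<^sup>*\<^sup>* ws y" by blast
  from step(2) have "comm_swap y z"
  proof cases
    case (1 s t n p q)
    have "\<not> 3 \<le> n" using good_no_braid[OF step.prems 1(6), of p q] y 1(1) by auto
    moreover have "2 \<le> n" using m_ge_2[of s t] 1 by (simp add: numeral_eq_enat)
    ultimately have n: "n = 2" by simp
    then have "wp (alt s t 2) = wp (alt t s 2)" using braid_relation 1 by blast
    then have "s \<otimes> t = t \<otimes> s" using 1 S_sub by (simp add: numeral_eq_Suc)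
    then show ?thesis using comm_swap.intros[of s t p q] 1 n by (simp add: numeral_eq_Suc)
  qed
  with y show ?case by (rule rtranclp.rtrancl_into_rtrancl)
qed simp

text \<open>A descent \<open>s\<close> of \<open>u\<close> could be brought to the front of
  \<open>u\<close> by commutations, thanks to Matsumoto's theorem, and would create a square in
  \<open>s # u\<close>.\<close>

lemma good_red: "good ws \<Longrightarrow> red ws"
proof (induction ws)
  case Nil show ?case by (rule red_Nil)
next
  case (Cons s u)
  have u: "good u" "red u" using good_Cons Cons by auto
  have s: "s \<in> S" using good_S[OF Cons.prems] by simp
  show ?case
  proof (rule ccontr)
    assume "\<not> red (s # u)"
    then have "left_descent (wp u) s" using left_descent_iff u s by blast
    then obtain u' where u': "red (s # u')" "wp (s # u') = wp u" using left_descent_word u s by blast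
    then have "comm_swap\<^sup>*\<^sup>* u (s # u')" using matsumoto[OF u(2) u'(1)] good_braid u(1) by simp
    then have "comm_swap\<^sup>*\<^sup>* (s # u) ([] @ [s, s] @ u')" using comm_star_Cons by simp
    then show False using good_no_square Cons.prems by blast
  qed
qed

lemma good_comm_red:
  assumes "good ws" "red us" "wp us = wp ws" shows "comm_swap\<^sup>*\<^sup>* ws us"
  using good_braid[OF matsumoto[OF good_red[OF assms(1)] assms(2) assms(3)[symmetric]] assms(1)] .

lemma good_fully_commutative: "good ws \<Longrightarrow> fully_commutative (wp ws)"
  unfolding fully_commutative_def reduced_expr_iff
  using good_comm_red comm_star_sym good_S by (meson rtranclp_trans wp_closed)

text \<open>Non-commuting letters never pass each other, so the subword they form is an invariant.
  It separates the two sides of a braid relation.\<close>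

lemma comm_star_filter:
  assumes nc: "s \<otimes> t \<noteq> t \<otimes> s" and "comm_swap\<^sup>*\<^sup>* u v"
  shows "filter (\<lambda>x. x = s \<or> x = t) u = filter (\<lambda>x. x = s \<or> x = t) v"
  using assms(2)
proof (induction rule: rtranclp_induct)
  case (step y z)
  from step(2) show ?case unfolding step(3) by cases (use nc in auto)
qed simp

text \<open>A square would allow a shorter word; a braid factor of length at least 3 would lead to a
  reduced word with a different subword in \<open>s\<close> and \<open>t\<close>, outside the
  commutation class.\<close>

lemma fully_commutative_good:
  assumes fc: "fully_commutative w" and ws: "reduced_expr w ws"
  shows "good ws"
  unfolding good_def
proof (intro conjI allI impI)
  show S: "set ws \<subseteq> S" using ws by (simp add: reduced_expr_iff red_iff)
  have us: "reduced_expr w us \<and> set us \<subseteq> S" if "comm_swap\<^sup>*\<^sup>* ws us" for us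
    using that ws S comm_star_wp[OF that S] comm_star_set[OF that] mset_eq_length[OF comm_star_mset[OF that]]
    by (auto simp: reduced_expr_iff red_iff)
  {
    fix us p q s assume "comm_swap\<^sup>*\<^sup>* ws us"
    then have u: "reduced_expr w us" "set us \<subseteq> S" using us by auto
    show "us \<noteq> p @ [s, s] @ q"
    proof
      assume eq: "us = p @ [s, s] @ q"
      then have "wp (p @ q) = w" using u S_sub by (simp add: reduced_expr_iff)
      then have "ell w \<le> length (p @ q)" using ell_le[of "p @ q"] u(2) eq by simp
      moreover have "length us = ell w" using u(1) by (simp add: reduced_expr_def)
      ultimately show False using eq by simp
    qed
  next
    fix us p q s t n assume c: "comm_swap\<^sup>*\<^sup>* ws us" and n: "m s t = enat n" "3 \<le> n"
    then have u: "reduced_expr w us" "set us \<subseteq> S" using us by auto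
    show "us \<noteq> p @ alt s t n @ q"
    proof
      assume eq: "us = p @ alt s t n @ q"
      then have st: "s \<in> S" "t \<in> S" using u(2) alt_letters[of n s t] n by auto
      have "s \<noteq> t" using m_self[OF st(1)] n by (auto simp: one_enat_def)
      then have nc: "s \<otimes> t \<noteq> t \<otimes> s" using commute_iff_not_adj st n
        by (simp add: coxeter_adj_def numeral_eq_enat)
      have "wp (p @ alt t s n @ q) = wp us" using eq u(2) st braid_relation[OF st n(1)] by simp
      then have "reduced_expr w (p @ alt t s n @ q)"
        using u eq st by (simp add: reduced_expr_iff red_iff)
      then have "comm_swap\<^sup>*\<^sup>* us (p @ alt t s n @ q)"
        using fc u(1) unfolding fully_commutative_def by blast
      from comm_star_filter[OF nc this]
      have "filter (\<lambda>x. x = s \<or> x = t) (alt s t n) = filter (\<lambda>x. x = s \<or> x = t) (alt t s n)"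
        unfolding eq by simp
      moreover have "filter (\<lambda>x. x = s \<or> x = t) (alt s t n) = alt s t n"
        "filter (\<lambda>x. x = s \<or> x = t) (alt t s n) = alt t s n"
        using set_alt_subset[of s t n] set_alt_subset[of t s n] by (auto simp: filter_id_conv)
      ultimately have "alt s t n = alt t s n" by simp
      then show False using \<open>s \<noteq> t\<close> n by (cases n) auto
    qed
  }
qed

text \<open>A repeated letter can be moved next to its copy and cancelled.\<close>

lemma commuting_distinct_word:
  assumes "set ws \<subseteq> S" "\<forall>s\<in>set ws. \<forall>t\<in>set ws. s \<otimes> t = t \<otimes> s"
  shows "\<exists>us. distinct us \<and> set us \<subseteq> set ws \<and> wp us = wp ws"
  using assms
proof (induction ws)
  case Nil then show ?case by (intro exI[of _ "[]"]) auto
next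
  case (Cons s ws)
  then obtain us where us: "distinct us" "set us \<subseteq> set ws" "wp us = wp ws" by auto
  have uS: "set us \<subseteq> S" "s \<in> S" using us Cons by auto
  show ?case
  proof (cases "s \<in> set us")
    case False
    then show ?thesis using us by (intro exI[of _ "s # us"]) auto
  next
    case True
    have "x \<otimes> s = s \<otimes> x" if "x \<in> set us" for x using that us Cons.prems by auto
    then have "wp us = s \<otimes> wp (remove1 s us)"
      using True uS(1)
    proof (induction us)
      case (Cons x us)
      show ?case
      proof (cases "x = s")
        case False
        have "wp (x # us) = x \<otimes> (s \<otimes> wp (remove1 s us))" using Cons False by auto
        also have "\<dots> = s \<otimes> (x \<otimes> wp (remove1 s us))"
        proof -
          have "set (remove1 s us) \<subseteq> S" using Cons.prems set_remove1_subset[of s us] by auto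
          then show ?thesis using Cons.prems(1)[of x] Cons.prems(3) uS(2)
            by (simp add: m_assoc[symmetric] S_sub)
        qed
        finally show ?thesis using False by simp
      qed simp
    qed simp
    moreover have "set (remove1 s us) \<subseteq> S" using uS set_remove1_subset[of s us] by auto
    ultimately have "wp (remove1 s us) = wp (s # ws)" using us(3) uS by simp
    moreover have "set (remove1 s us) \<subseteq> set (s # ws)" "distinct (remove1 s us)"
      using us set_remove1_subset[of s us] by auto
    ultimately show ?thesis by blast
  qed
qed

text \<open>A word with distinct letters contains neither a square nor an alternating factor of
  length 3, hence is good; every reduced word of its element is then a rearrangement of it.\<close>

lemma commuting_product_distinct:
  assumes "commuting_product x" "good ws" "wp ws = x"
  shows "distinct ws"
proof -
  obtain us where us: "set us \<subseteq> S" "x = wp us" "\<forall>s\<in>set us. \<forall>t\<in>set us. s \<otimes> t = t \<otimes> s"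
    using assms(1) by (auto simp: commuting_product_def lists_eq_set)
  then obtain vs where vs: "distinct vs" "set vs \<subseteq> set us" "wp vs = x"
    using commuting_distinct_word by blast
  have "good vs"
    unfolding good_def
  proof (intro conjI allI impI)
    show "set vs \<subseteq> S" using vs us by blast
  next
    fix u p q s assume "comm_swap\<^sup>*\<^sup>* vs u"
    then show "u \<noteq> p @ [s, s] @ q" using comm_star_distinct[of vs u] vs by auto
  next
    fix u p q s t n assume c: "comm_swap\<^sup>*\<^sup>* vs u" and n: "m s t = enat n" "3 \<le> n"
    obtain k where "n = 3 + k" using le_Suc_ex[OF n(2)] by blast
    then have k: "n = Suc (Suc (Suc k))" by simp
    show "u \<noteq> p @ alt s t n @ q" using comm_star_distinct[OF c vs(1)] k by auto
  qed
  then have "comm_swap\<^sup>*\<^sup>* vs ws" using good_comm_red good_red assms vs by simp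
  then show ?thesis using comm_star_distinct vs by blast
qed

subsection \<open>Star reductions of words\<close>

lemma ell_inv: assumes "w \<in> carrier G" shows "ell (inv w) = ell w"
proof -
  obtain ws where ws: "red ws" "wp ws = w" using reduced_exists[OF assms] by blast
  then have "wp (rev ws) = inv w" using inv_wp[of ws] by (simp add: red_iff)
  then show ?thesis using red_rev[OF ws(1)] ws by (simp add: red_iff)
qed

text \<open>String elements are alternating words followed by \<open>v\<close>, and these are
  reduced because \<open>v\<close> has no descent in \<open>{s, t}\<close>. A length difference of
  one therefore strips exactly the first letter.\<close>

lemma left_star_reducible_word:
  assumes "left_star_reducible y z"
  obtains s t u where "adj s t" "red (s # t # u)" "wp (s # t # u) = y" "wp (t # u) = z"
proof -
  obtain s t v where st: "s \<in> S" "t \<in> S" "s \<otimes> t \<noteq> t \<otimes> s" and v: "v \<in> carrier G"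
    "\<not> left_descent v s" "\<not> left_descent v t"
    and str: "z \<in> left_string s t v" "y \<in> left_string s t v" "ell y = Suc (ell z)"
    using assms unfolding left_star_reducible_def by blast
  have ne: "s \<noteq> t" using st by auto
  obtain vs where vs: "red vs" "wp vs = v" using reduced_exists[OF v(1)] by blast
  then have vS: "set vs \<subseteq> S" by (simp add: red_iff)
  have red: "red (rev (alt s t n) @ vs)" if "enat n < m s t" for n
    unfolding rev_alt
    using no_descents_alt_reduced[OF st(1,2) ne _ vs(1), of n]
      no_descents_alt_reduced[OF st(2,1) ne[symmetric] _ vs(1), of n] v vs(2) that m_sym[OF st(1,2)] by auto
  have wpn: "wp (rev (alt s t n) @ vs) = wp (rev (alt s t n)) \<otimes> v" for n using st vS vs by simp
  obtain n k where nk: "1 \<le> k" "enat k < m s t" "z = wp (rev (alt s t k)) \<otimes> v"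
    "enat n < m s t" "y = wp (rev (alt s t n)) \<otimes> v"
    using str(1,2) unfolding left_string_def by blast
  have "n = Suc k" using str(3) red[OF nk(2)] red[OF nk(4)] nk(3,5) wpn[of n] wpn[of k] by (simp add: red_iff)
  obtain j where j: "k = Suc j" using nk(1) by (cases k) auto
  \<comment> \<open>Strings grow on the left, so which generator leads depends on the parity of
    \<open>k\<close>.\<close>
  define c d where "c = (if even k then s else t)" and "d = (if even k then t else s)"
  define u where "u = rev (alt s t j) @ vs"
  have k: "rev (alt s t k) @ vs = d # u" unfolding j alt_Suc_snoc by (simp add: d_def u_def j)
  have n: "rev (alt s t n) @ vs = c # d # u"
    using k unfolding \<open>n = Suc k\<close> alt_Suc_snoc[of s t k] by (simp add: c_def)
  have "adj c d" using commute_iff_not_adj[OF st(1,2) ne] st(3) adj_sym by (auto simp: c_def d_def)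
  then show ?thesis
    using that[of c d u] red[OF nk(4)] wpn[of n] wpn[of k] nk(3,5) unfolding n k by simp
qed

lemma right_star_reducible_inv:
  assumes "right_star_reducible y z"
  shows "left_star_reducible (inv y) (inv z)"
proof -
  obtain s t v where st: "s \<in> S" "t \<in> S" "s \<otimes> t \<noteq> t \<otimes> s" and v: "v \<in> carrier G"
    "\<not> right_descent v s" "\<not> right_descent v t"
    and str: "z \<in> right_string s t v" "y \<in> right_string s t v" "ell y = Suc (ell z)"
    using assms unfolding right_star_reducible_def by blast
  have desc: "left_descent (inv v) a \<Longrightarrow> right_descent v a" if "a \<in> S" for a
  proof -
    assume "left_descent (inv v) a"
    moreover have "inv (v \<otimes> a) = a \<otimes> inv v" using that v(1) by (simp add: inv_mult_group S_sub)
    ultimately have "ell (inv (v \<otimes> a)) < ell (inv v)" unfolding left_descent_def by simp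
    moreover have "v \<otimes> a \<in> carrier G" using that v(1) by (simp add: S_sub)
    ultimately show "right_descent v a" using that v(1) ell_inv unfolding right_descent_def by simp
  qed
  have "inv x \<in> left_string s t (inv v) \<and> x \<in> carrier G" if x: "x \<in> right_string s t v" for x
  proof -
    obtain n where "1 \<le> n" "enat n < m s t" "x = v \<otimes> wp (alt s t n)"
      using x by (auto simp: right_string_def)
    moreover have "inv (v \<otimes> wp (alt s t n)) = wp (rev (alt s t n)) \<otimes> inv v"
      using v(1) st(1,2) by (simp add: inv_mult_group inv_wp)
    moreover have "v \<otimes> wp (alt s t n) \<in> carrier G" using v(1) st(1,2) by simp
    ultimately show ?thesis unfolding left_string_def by blast
  qed
  then show ?thesis
    unfolding left_star_reducible_def using st v desc str
    by (intro bexI[of _ s] bexI[of _ t] bexI[of _ "inv v"]) (auto simp: ell_inv)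
qed

text \<open>Invariance under swaps makes \<open>Q\<close> a property of the element rather than of
  the word, and invariance under reversal covers right reductions. The path is traversed from its
  end, a product of commuting generators, whose good words have distinct letters.\<close>

lemma good_word_induct [consumes 2, case_names swap rev distinct step]:
  assumes sr: "star_reducible" and good: "good ws"
    and swap: "\<And>u v. comm_swap u v \<Longrightarrow> Q u \<Longrightarrow> Q v"
    and rev: "\<And>u. Q u \<Longrightarrow> Q (rev u)"
    and base: "\<And>u. distinct u \<Longrightarrow> Q u"
    and step: "\<And>s t u. good (s # t # u) \<Longrightarrow> adj s t \<Longrightarrow> Q (t # u) \<Longrightarrow> Q (s # t # u)"
  shows "Q ws"
proof -
  have swaps: "Q v" if "comm_swap\<^sup>*\<^sup>* u v" "Q u" for u v
    using that by (induction rule: rtranclp_induct) (auto intro: swap)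
  have left: "Q us" if l: "left_star_reducible y z" and us: "good us" "wp us = y"
    and IH: "\<And>vs. good vs \<Longrightarrow> wp vs = z \<Longrightarrow> Q vs" for y z us
  proof -
    obtain s t u where u: "adj s t" "red (s # t # u)" "wp (s # t # u) = y" "wp (t # u) = z"
      using left_star_reducible_word[OF l] by blast
    have c: "comm_swap\<^sup>*\<^sup>* us (s # t # u)" using good_comm_red us u by simp
    have g: "good (s # t # u)" using good_comm us c by blast
    have "Q (t # u)" using IH good_Cons[OF g] u(4) by blast
    then have "Q (s # t # u)" using step g u(1) by blast
    then show ?thesis using swaps comm_star_sym[OF c] by blast
  qed
  obtain x where x: "commuting_product x" "star_reducible_to (wp ws) x"
    using sr good_fully_commutative[OF good] unfolding star_reducible_def by blast
  have "\<forall>us. good us \<longrightarrow> wp us = y \<longrightarrow> Q us" if "star_reducible_to y x" for y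
    using that unfolding star_reducible_to_def
  proof (induction rule: converse_rtranclp_induct)
    case base
    then show ?case using commuting_product_distinct[OF x(1)] assms(5) by blast
  next
    case (step y z)
    show ?case
    proof (intro allI impI)
      fix us assume us: "good us" "wp us = y"
      from step(1) show "Q us"
      proof
        assume "left_star_reducible y z"
        then show ?thesis using left us step(3) by blast
      next
        assume r: "right_star_reducible y z"
        have "Q (rev us)"
        proof (rule left[OF right_star_reducible_inv[OF r]])
          show "good (rev us)" using good_rev us(1) .
          show "wp (rev us) = inv y" using inv_wp[OF good_S[OF us(1)]] us(2) by simp
          fix vs assume vs: "good vs" "wp vs = inv z"
          have "z \<in> carrier G"
          proof -
            obtain s t v n where "s \<in> S" "t \<in> S" "v \<in> carrier G" "z = v \<otimes> wp (alt s t n)"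
              using r unfolding right_star_reducible_def right_string_def by blast
            then show ?thesis by simp
          qed
          then have "wp (rev vs) = z" using inv_wp[OF good_S[OF vs(1)]] vs(2) by simp
          then have "Q (rev vs)" using step(3) good_rev[OF vs(1)] by blast
          then show "Q vs" using rev[of "rev vs"] by simp
        qed
        then show ?thesis using rev[of "rev us"] by simp
      qed
    qed
  qed
  then show ?thesis using x(2) good by blast
qed

subsection \<open>Deleting the second letter\<close>

text \<open>The initial \<open>s\<close> is tracked through the swaps. \<open>A\<close> collects the
  letters that have moved in front of it; they commute with \<open>s\<close>. Forgetting the tracked
  letter turns each swap into a swap of the rest or into no change.\<close>

lemma comm_star_first:
  assumes "comm_swap\<^sup>*\<^sup>* (s # ws) us"
  shows "\<exists>A B. us = A @ s # B \<and> s \<notin> set A \<and> (\<forall>a\<in>set A. a \<otimes> s = s \<otimes> a) \<and> comm_swap\<^sup>*\<^sup>* ws (A @ B)"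
  using assms
proof (induction rule: rtranclp_induct)
  case base
  show ?case by (intro exI[of _ "[]"] exI[of _ ws]) auto
next
  case (step y z)
  then obtain A B where AB: "y = A @ s # B" "s \<notin> set A" "\<forall>a\<in>set A. a \<otimes> s = s \<otimes> a"
    "comm_swap\<^sup>*\<^sup>* ws (A @ B)" by blast
  from step(2) show ?case
  proof cases
    case (1 a b p q)
    have eq: "A @ s # B = p @ a # b # q" using AB 1 by simp
    consider (in_A) A' where "A = p @ a # b # A'" "q = A' @ s # B"
      | (left) "A = p @ [a]" "b = s" "B = q"
      | (right) "A = p" "a = s" "B = b # q"
      | (in_B) p' where "p = A @ s # p'" "B = p' @ a # b # q"
      using eq by (auto simp: append_eq_append_conv2 append_eq_Cons_conv Cons_eq_append_conv)
    then show ?thesis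
    proof cases
      case in_A
      have "comm_swap (A @ B) ((p @ b # a # A') @ B)"
        using comm_swap.intros[of a b p "A' @ B"] 1 in_A by simp
      then show ?thesis using AB 1 in_A
        by (intro exI[of _ "p @ b # a # A'"] exI[of _ B]) (auto intro: rtranclp.rtrancl_into_rtrancl)
    next
      case left
      then show ?thesis using AB 1 by (intro exI[of _ p] exI[of _ "a # q"]) auto
    next
      case right
      show ?thesis
      proof (cases "b = s")
        case True
        \<comment> \<open>Swapping equal letters changes nothing; the left copy remains the tracked
          one, which keeps \<open>s\<close> out of \<open>A\<close>.\<close>
        then show ?thesis using AB 1 right by (intro exI[of _ A] exI[of _ B]) auto
      next
        case False
        then show ?thesis using AB 1 right by (intro exI[of _ "A @ [b]"] exI[of _ q]) auto
      qed
    next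
      case in_B
      have "comm_swap (A @ B) (A @ p' @ b # a # q)"
        using comm_swap.intros[of a b "A @ p'" q] 1 in_B by simp
      then show ?thesis using AB 1 in_B
        by (intro exI[of _ A] exI[of _ "p' @ b # a # q"]) (auto intro: rtranclp.rtrancl_into_rtrancl)
    qed
  qed
qed

definition nbrs_before :: "'a \<Rightarrow> 'a list \<Rightarrow> nat" where
  "nbrs_before s ws = length (filter (\<lambda>a. a \<otimes> s \<noteq> s \<otimes> a) (takeWhile (\<lambda>a. a \<noteq> s) ws))"

text \<open>A letter crossing the first \<open>s\<close> commutes with it and is not counted; other
  swaps keep letters on their side of it.\<close>

lemma nbrs_before_comm: "comm_swap\<^sup>*\<^sup>* u v \<Longrightarrow> nbrs_before s u = nbrs_before s v"
proof (induction rule: rtranclp_induct)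
  case (step y z)
  from step(2) have "nbrs_before s y = nbrs_before s z"
  proof cases
    case (1 a b p q)
    have "nbrs_before s (p @ a # b # q) = nbrs_before s (p @ b # a # q)"
      by (induction p) (use 1 in \<open>auto simp: nbrs_before_def\<close>)
    then show ?thesis using 1 by simp
  qed
  then show ?case using step by simp
qed simp

lemma nbrs_before_append:
  assumes "s \<notin> set A" "\<forall>a\<in>set A. a \<otimes> s = s \<otimes> a"
  shows "nbrs_before s (A @ B) = nbrs_before s B"
  using assms by (induction A) (auto simp: nbrs_before_def)

lemma alt_neighbour:
  assumes "alt x y n = F1 @ s # F2" "F1 \<noteq> []" "x \<in> S" "y \<in> S" "x \<otimes> y \<noteq> y \<otimes> x"
  shows "last F1 \<otimes> s \<noteq> s \<otimes> last F1"
  using assms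
proof (induction n arbitrary: x y F1)
  case (Suc n)
  then obtain F where F: "F1 = x # F" by (cases F1) auto
  show ?case
  proof (cases "F = []")
    case True
    then have "s = y" using Suc.prems F by (cases n) auto
    then show ?thesis using True F Suc.prems by simp
  next
    case False
    then show ?thesis using Suc.IH[of y x F] Suc.prems F by auto
  qed
qed simp

text \<open>
  A forbidden factor of a word equivalent to \<open>s w\<close> must start with the first letter \<open>s\<close>, so at
  most one letter not commuting with \<open>s\<close> precedes the next \<open>s\<close>.
\<close>

lemma good_Cons_if_nbrs:
  assumes good: "good ws" and s: "s \<in> S" and two: "2 \<le> nbrs_before s ws"
  shows "good (s # ws)"
  unfolding good_def
proof (intro conjI allI impI)
  show "set (s # ws) \<subseteq> S" using s good_S[OF good] by simp
  have key: "False" if c: "comm_swap\<^sup>*\<^sup>* (s # ws) (p @ F @ q)"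
    and F0: "\<And>p' q'. \<not> comm_swap\<^sup>*\<^sup>* ws (p' @ F @ q')"
    and F1: "\<And>F1 F2. F = F1 @ s # F2 \<Longrightarrow> F1 \<noteq> [] \<Longrightarrow> last F1 = s \<or> last F1 \<otimes> s \<noteq> s \<otimes> last F1"
    and F2: "\<And>F2. F = s # F2 \<Longrightarrow> nbrs_before s (F2 @ q) \<le> 1" for p F q
  proof -
    obtain A B where AB: "p @ F @ q = A @ s # B" "s \<notin> set A" "\<forall>a\<in>set A. a \<otimes> s = s \<otimes> a"
      "comm_swap\<^sup>*\<^sup>* ws (A @ B)" using comm_star_first[OF c] by blast
    \<comment> \<open>If the tracked \<open>s\<close> lies outside the factor, deleting it leaves
      the factor in a word equivalent to \<open>ws\<close>. If it lies inside but not in front, its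
      predecessor in the factor belongs to \<open>A\<close> and yet equals \<open>s\<close> or fails
      to commute with it.\<close>
    consider (left) A' where "A = p @ F @ A'" | (right) p' where "p = A @ s # p'" "B = p' @ F @ q"
      | (mid) H1 H2 where "A = p @ H1" "F = H1 @ s # H2" "B = H2 @ q"
      using AB(1) by (auto simp: append_eq_append_conv2 append_eq_Cons_conv Cons_eq_append_conv)
    then show False
    proof cases
      case left
      then show False using F0[of p "A' @ B"] AB(4) by simp
    next
      case right
      then show False using F0[of "A @ p'" q] AB(4) by simp
    next
      case mid
      have "H1 = []"
      proof (rule ccontr)
        assume "H1 \<noteq> []"
        then have "last H1 \<in> set A" using mid by simp
        then show False using F1[OF mid(2) \<open>H1 \<noteq> []\<close>] AB by auto
      qed
      then have "nbrs_before s B \<le> 1" using F2 mid by simp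
      then show False
        using two nbrs_before_comm[OF AB(4), of s] nbrs_before_append[OF AB(2,3), of B] by simp
    qed
  qed
  {
    fix us p q x assume c: "comm_swap\<^sup>*\<^sup>* (s # ws) us"
    show "us \<noteq> p @ [x, x] @ q"
    proof
      assume "us = p @ [x, x] @ q"
      with c have "comm_swap\<^sup>*\<^sup>* (s # ws) (p @ [x, x] @ q)" by simp
      then show False
      proof (rule key)
        show "\<not> comm_swap\<^sup>*\<^sup>* ws (p' @ [x, x] @ q')" for p' q' using good_no_square[OF good] by blast
      qed (auto simp: Cons_eq_append_conv nbrs_before_def)
    qed
  next
    fix us p q x y n assume c: "comm_swap\<^sup>*\<^sup>* (s # ws) us" and n: "m x y = enat n" "3 \<le> n"
    show "us \<noteq> p @ alt x y n @ q"
    proof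
      assume eq: "us = p @ alt x y n @ q"
      have "set us \<subseteq> S" using comm_star_set[OF c] s good_S[OF good] by auto
      then have xy: "x \<in> S" "y \<in> S" using eq alt_letters[of n x y] n by auto
      have "x \<noteq> y" using m_self[OF xy(1)] n by (auto simp: one_enat_def)
      then have nc: "x \<otimes> y \<noteq> y \<otimes> x" using commute_iff_not_adj xy n
        by (simp add: coxeter_adj_def numeral_eq_enat)
      obtain k where "n = 3 + k" using le_Suc_ex[OF n(2)] by blast
    then have k: "n = Suc (Suc (Suc k))" by simp
      have "comm_swap\<^sup>*\<^sup>* (s # ws) (p @ alt x y n @ q)" using c eq by simp
      then show False
      proof (rule key)
        show "\<not> comm_swap\<^sup>*\<^sup>* ws (p' @ alt x y n @ q')" for p' q' using good_no_braid[OF good n] by blast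
        show "last F1 = s \<or> last F1 \<otimes> s \<noteq> s \<otimes> last F1" if "alt x y n = F1 @ s # F2" "F1 \<noteq> []" for F1 F2
          using alt_neighbour[OF that xy nc] by simp
        \<comment> \<open>After the leading \<open>x\<close> come \<open>y\<close> and then
          \<open>x\<close> again, as \<open>n \<ge> 3\<close>, so only the one \<open>y\<close> is
          counted.\<close>
        show "nbrs_before s (F2 @ q) \<le> 1" if "alt x y n = s # F2" for F2
          using that k \<open>x \<noteq> y\<close> by (auto simp: nbrs_before_def)
      qed
    qed
  }
qed

text \<open>Apart from the vertex of \<open>t\<close>, the boundary of the edge consists of letters
  of \<open>ws\<close> that are adjacent to \<open>s\<close> and precede its next occurrence. Two of
  them give \<open>nbrs_before s ws \<ge> 2\<close>. Positions shift by 2 since \<open>s\<close> and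
  \<open>t\<close> stand before \<open>ws\<close>.\<close>

lemma good_drop_second:
  assumes good: "good (s # t # ws)" and e: "(0, j) \<in> word_edges (s # t # ws)"
    and xy: "x \<in> word_bd adj (s # t # ws) (0, j) - {Suc 0}"
      "y \<in> word_bd adj (s # t # ws) (0, j) - {Suc 0}" "x \<noteq> y"
  shows "good (s # ws)"
proof -
  have S: "s \<in> S" "set ws \<subseteq> S" using good_S[OF good] by auto
  define T where "T = takeWhile (\<lambda>a. a \<noteq> s) ws"
  let ?N = "{i. i < length T \<and> T ! i \<otimes> s \<noteq> s \<otimes> T ! i}"
  have "j - 2 \<le> length T"
    unfolding T_def
  proof (rule length_takeWhile_less_P_nth)
    show "ws ! i \<noteq> s" if "i < j - 2" for i
    proof -
      have "\<forall>k. 0 < k \<and> k < j \<longrightarrow> (s # t # ws) ! k \<noteq> (s # t # ws) ! 0"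
        using e unfolding word_edges_def by blast
      from this[rule_format, of "Suc (Suc i)"] that show ?thesis by simp
    qed
    show "j - 2 \<le> length ws" using e by (auto simp: word_edges_def)
  qed
  have mem: "z - 2 \<in> ?N \<and> 2 \<le> z" if "z \<in> word_bd adj (s # t # ws) (0, j) - {Suc 0}" for z
  proof -
    have z: "2 \<le> z" "z < j" "adj ((s # t # ws) ! z) s" using that by (auto simp: word_bd_def)
    obtain i where i: "z = Suc (Suc i)" using z(1) by (metis add_2_eq_Suc le_Suc_ex)
    have l: "i < length T" using \<open>j - 2 \<le> length T\<close> z i by simp
    then have "T ! i = ws ! i" unfolding T_def by (rule takeWhile_nth)
    moreover have "adj (ws ! i) s" using z i by simp
    moreover have "ws ! i \<in> S" "ws ! i \<noteq> s" using \<open>adj (ws ! i) s\<close> by (auto simp: coxeter_adj_def)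
    ultimately show ?thesis using l i commute_iff_not_adj[of "ws ! i" s] S by simp
  qed
  have "{x - 2, y - 2} \<subseteq> ?N" "x - 2 \<noteq> y - 2" using mem[OF xy(1)] mem[OF xy(2)] xy(3) by auto
  then have "2 \<le> card ?N" using card_mono[of ?N "{x - 2, y - 2}"] by simp
  then have "2 \<le> nbrs_before s ws" by (simp add: nbrs_before_def length_filter_conv_card T_def)
  then show ?thesis using good_Cons_if_nbrs good_Cons[OF good_Cons[OF good]] S by blast
qed

subsection \<open>Boundary vertices of fully commutative words\<close>

lemma comm_swap_acyclic: "comm_swap u v \<Longrightarrow> word_acyclic K adj u \<Longrightarrow> word_acyclic K adj v"
proof (erule comm_swap.cases)
  fix s t p q assume *: "word_acyclic K adj u" "u = p @ [s, t] @ q" "v = p @ [t, s] @ q" "s \<in> S" "t \<in> S" "s \<otimes> t = t \<otimes> s"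
  show "word_acyclic K adj v"
  proof (cases "s = t")
    case False
    then show ?thesis using * word_swap_acyclic[of s t adj K p q] commute_iff_not_adj adj_sym by blast
  qed (use * in simp)
qed

lemma comm_swap_effective: "comm_swap u v \<Longrightarrow> word_effective K adj u \<Longrightarrow> word_effective K adj v"
proof (erule comm_swap.cases)
  fix s t p q assume *: "word_effective K adj u" "u = p @ [s, t] @ q" "v = p @ [t, s] @ q" "s \<in> S" "t \<in> S" "s \<otimes> t = t \<otimes> s"
  show "word_effective K adj v"
  proof (cases "s = t")
    case False
    then show ?thesis using * word_swap_effective[of s t adj K p q] commute_iff_not_adj adj_sym by blast
  qed (use * in simp)
qed

lemma good_acyclic:
  assumes "star_reducible" "good ws"
  shows "word_acyclic (K::'k::field itself) adj ws"
  using assms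
proof (induction rule: good_word_induct)
  case (step s t u)
  have "s \<noteq> t" using step(2) by (auto simp: coxeter_adj_def)
  from word_acyclic_step[of adj, OF adj_sym[OF step(2)] this step(3)] show ?case .
next
  case (swap u v) then show ?case by (rule comm_swap_acyclic)
next
  case (rev u) then show ?case by (rule word_rev_acyclic)
next
  case (distinct u) then show ?case by (simp add: word_edges_distinct)
qed

lemma good_effective:
  assumes "star_reducible" "bipartite_graph S adj" "good ws"
  shows "word_effective TYPE('k::field) adj ws"
  using assms(1,3)
proof (induction rule: good_word_induct)
  case (step s t u)
  obtain A B where AB: "A \<union> B = S" "A \<inter> B = {}" "\<forall>s\<in>A. \<forall>t\<in>A. \<not> adj s t" "\<forall>s\<in>B. \<forall>t\<in>B. \<not> adj s t"
    using assms(2) unfolding bipartite_graph_def by blast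
  show ?case
  proof (rule word_effective_step[where col = "\<lambda>x. x \<in> A"])
    show "(a \<in> A) \<noteq> (b \<in> A)" if "adj a b" for a b
    proof -
      have "a \<in> S" "b \<in> S" using that by (auto simp: coxeter_adj_def)
      then show ?thesis using that AB by blast
    qed
    show "adj t s" using step(2) by (rule adj_sym)
    show "word_acyclic TYPE('k) adj (s # u)" if "(0, j) \<in> word_edges (s # t # u)"
      "x \<in> word_bd adj (s # t # u) (0, j) - {Suc 0}" "y \<in> word_bd adj (s # t # u) (0, j) - {Suc 0}" "x \<noteq> y"
      for j x y
      using good_acyclic[OF assms(1) good_drop_second[OF step(1) that]] .
  qed (rule step(3))
next
  case (swap u v) then show ?case by (rule comm_swap_effective)
next
  case (rev u) then show ?case by (rule word_rev_effective)
next
  case (distinct u) then show ?case by (simp add: word_edges_distinct)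
qed

end

section \<open>Transfer to heaps\<close>

text \<open>Generating steps of the heap order never decrease the position, and equal or adjacent
  labels are related in one step.\<close>

lemma word_heap_leq_iff:
  assumes "i < length ws" "j < length ws" "ws ! i = ws ! j \<or> adj (ws ! i) (ws ! j)"
  shows "leq (word_heap adj ws) i j \<longleftrightarrow> i \<le> j"
proof
  assume "leq (word_heap adj ws) i j"
  then have "(\<lambda>a b. a < length ws \<and> b < length ws \<and> a \<le> b \<and>
              (ws ! a = ws ! b \<or> adj (ws ! a) (ws ! b)))\<^sup>*\<^sup>* i j"
    by (simp add: word_heap_def)
  then show "i \<le> j" by (induction rule: rtranclp_induct) auto
next
  assume "i \<le> j"
  then show "leq (word_heap adj ws) i j" using assms by (auto simp: word_heap_def)
qed

definition heap_bd :: "('s \<Rightarrow> 's \<Rightarrow> bool) \<Rightarrow> ('e, 's) labelled_poset \<Rightarrow> 'e \<times> 'e \<Rightarrow> 'e set" where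
  "heap_bd adj E e = {z \<in> elts E. lt E (fst e) z \<and> lt E z (snd e) \<and>
     (lab E z = lab E (fst e) \<or> adj (lab E z) (lab E (fst e)))}"

lemma boundary_edge_eq: "boundary_edge adj E e = (\<Sum>z\<in>heap_bd adj E e. Poly_Mapping.single z 1)"
  by (cases e) (simp add: boundary_edge_def heap_bd_def)

lemma boundary_map_single: "boundary_map adj E (Poly_Mapping.single e 1) = (boundary_edge adj E e :: 'e \<Rightarrow>\<^sub>0 'k::field)"
  by (rule poly_mapping_eqI) (simp add: boundary_map_def Poly_Mapping.map.rep_eq when_def)

text \<open>Boundaries of edges have coefficients 0 and 1, so the sets \<open>heap_bd\<close>
  determine the linear map; edges outside the support of \<open>c\<close> contribute 0.\<close>

lemma lookup_boundary_map:
  assumes fin: "finite (edges E)" "finite (elts E)" and c: "Poly_Mapping.keys c \<subseteq> edges E"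
  shows "Poly_Mapping.lookup (boundary_map adj E c :: 'e \<Rightarrow>\<^sub>0 'k::field) x =
    bsum (edges E) (heap_bd adj E) (Poly_Mapping.lookup c) x"
proof -
  have fb: "finite (heap_bd adj E e)" for e using fin(2) by (simp add: heap_bd_def)
  have b: "Poly_Mapping.lookup (boundary_edge adj E e :: 'e \<Rightarrow>\<^sub>0 'k) x = (if x \<in> heap_bd adj E e then 1 else 0)" for e
    unfolding boundary_edge_eq lookup_sum lookup_single using fb by (simp add: when_def)
  have "Poly_Mapping.lookup (boundary_map adj E c) x =
    (\<Sum>e\<in>Poly_Mapping.keys c. if x \<in> heap_bd adj E e then Poly_Mapping.lookup c e else 0)"
    unfolding boundary_map_def lookup_sum
    by (intro sum.cong) (auto simp: Poly_Mapping.map.rep_eq b when_def)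
  also have "\<dots> = bsum (edges E) (heap_bd adj E) (Poly_Mapping.lookup c) x"
    unfolding bsum_def by (rule sum.mono_neutral_left) (use fin c in \<open>auto simp: in_keys_iff\<close>)
  finally show ?thesis .
qed

text \<open>Edges and boundaries compare only vertices with equal or adjacent labels, where heap
  order agrees with position. An isomorphism of labelled posets is therefore one of incidence
  structures.\<close>

lemma word_heap_iso:
  assumes iso: "labelled_poset_iso (word_heap adj ws) E"
    and sym: "\<And>a b. adj a b \<Longrightarrow> adj b a"
  obtains f where "inj_on f {..<length ws}" "elts E = f ` {..<length ws}"
    "bij_betw (map_prod f f) (word_edges ws) (edges E)"
    "\<And>e. e \<in> word_edges ws \<Longrightarrow> heap_bd adj E (map_prod f f e) = f ` word_bd adj ws e"
proof -
  let ?n = "length ws"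
  obtain f where bij: "bij_betw f {..<?n} (elts E)"
    and lab: "\<And>i. i < ?n \<Longrightarrow> lab E (f i) = ws ! i"
    and leq: "\<And>i j. i < ?n \<Longrightarrow> j < ?n \<Longrightarrow> leq E (f i) (f j) \<longleftrightarrow> leq (word_heap adj ws) i j"
    using iso unfolding labelled_poset_iso_def by (auto simp: word_heap_def)
  have inj: "inj_on f {..<?n}" and img: "elts E = f ` {..<?n}" using bij by (auto simp: bij_betw_def)
  have lt: "lt E (f i) (f j) \<longleftrightarrow> i < j" if "i < ?n" "j < ?n" "ws ! i = ws ! j \<or> adj (ws ! i) (ws ! j)" for i j
    using leq[OF that(1,2)] word_heap_leq_iff[of i ws j adj, OF that] inj_onD[OF inj, of i j] that
    unfolding lt_def by (cases "i = j") auto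
  have E: "(f i, f j) \<in> edges E \<longleftrightarrow> (i, j) \<in> word_edges ws" if ij: "i < ?n" "j < ?n" for i j
  proof (cases "ws ! i = ws ! j")
    case True
    have "(\<exists>z\<in>elts E. lt E (f i) z \<and> lt E z (f j) \<and> lab E z = lab E (f i)) \<longleftrightarrow>
      (\<exists>k<?n. lt E (f i) (f k) \<and> lt E (f k) (f j) \<and> ws ! k = ws ! i)"
      unfolding img using lab ij by auto
    also have "\<dots> \<longleftrightarrow> (\<exists>k. i < k \<and> k < j \<and> ws ! k = ws ! i)"
      using lt ij True by (auto intro: less_trans)
    finally show ?thesis using True ij lab lt[of i j] unfolding edges_def word_edges_def by (auto simp: img)
  next
    case False
    then show ?thesis using lab ij by (auto simp: edges_def word_edges_def)
  qed
  have edges: "bij_betw (map_prod f f) (word_edges ws) (edges E)"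
    unfolding bij_betw_def
  proof
    show "inj_on (map_prod f f) (word_edges ws)"
      using inj by (auto simp: inj_on_def word_edges_def)
    show "map_prod f f ` word_edges ws = edges E"
    proof (intro equalityI subsetI)
      fix e assume "e \<in> map_prod f f ` word_edges ws"
      then obtain i j where ij: "(i, j) \<in> word_edges ws" "e = (f i, f j)" by auto
      then have "i < ?n" "j < ?n" by (auto simp: word_edges_def)
      with ij E show "e \<in> edges E" by simp
    next
      fix e assume e: "e \<in> edges E"
      then obtain i j where "i < ?n" "j < ?n" "e = (f i, f j)" by (auto simp: edges_def img)
      with e E show "e \<in> map_prod f f ` word_edges ws" by force
    qed
  qed
  have "heap_bd adj E (map_prod f f e) = f ` word_bd adj ws e" if e: "e \<in> word_edges ws" for e
  proof -
    obtain i j where ij: "e = (i, j)" by force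
    with e have l: "i < j" "i < ?n" "j < ?n" "ws ! i = ws ! j"
      "\<And>k. i < k \<Longrightarrow> k < j \<Longrightarrow> ws ! k \<noteq> ws ! j" by (auto simp: word_edges_def)
    \<comment> \<open>An edge joins consecutive occurrences of its label, so the alternative of an
      equal label in \<open>heap_bd\<close> never occurs strictly between the ends.\<close>
    have "lt E (f i) (f k) \<and> lt E (f k) (f j) \<and> (ws ! k = ws ! i \<or> adj (ws ! k) (ws ! i)) \<longleftrightarrow> k \<in> word_bd adj ws e"
      if k: "k < ?n" for k
      using lt[of i k] lt[of k j] l k sym by (auto simp: word_bd_def ij)
    then have "{k \<in> {..<?n}. lt E (f i) (f k) \<and> lt E (f k) (f j) \<and> (ws ! k = ws ! i \<or> adj (ws ! k) (ws ! i))} =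
      word_bd adj ws e" using word_bd_subset[OF e] by auto
    moreover have "heap_bd adj E (map_prod f f e) =
      f ` {k \<in> {..<?n}. lt E (f i) (f k) \<and> lt E (f k) (f j) \<and> (ws ! k = ws ! i \<or> adj (ws ! k) (ws ! i))}"
      unfolding heap_bd_def img ij using lab l(2) by auto
    ultimately show ?thesis by simp
  qed
  then show ?thesis by (rule that[OF inj img edges])
qed

theorem theorem3p4p1:
  fixes G :: "('a, 'b) monoid_scheme"
    and S :: "'a set"
    and m :: "'a \<Rightarrow> 'a \<Rightarrow> enat"
    and w :: 'a
    and E :: "('e, 'a) labelled_poset"
    and v :: 'e
  assumes "coxeter_system G S m"
    and "bipartite_graph S (coxeter_adj S m)"
    and "coxeter_system.star_reducible G S m"
    and "coxeter_system.fully_commutative G S w"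
    and "coxeter_system.heap_of G S m w E"
    and "boundary_vertex TYPE('k::field) (coxeter_adj S m) E v"
  shows "\<exists>u. effective_boundary_vertex TYPE('k) (coxeter_adj S m) E u \<and>
             linearly_equivalent TYPE('k) (coxeter_adj S m) E v u"
proof -
  interpret coxeter_system G S m by fact
  obtain ws where ws: "reduced_expr w ws" and iso: "labelled_poset_iso (word_heap adj ws) E"
    using assms(5) unfolding heap_of_def by blast
  have eff: "word_effective TYPE('k) adj ws"
    using good_effective[OF assms(3,2)] fully_commutative_good[OF assms(4) ws] by blast
  obtain f where f: "inj_on f {..<length ws}" "elts E = f ` {..<length ws}"
    "bij_betw (map_prod f f) (word_edges ws) (edges E)"
    "\<And>e. e \<in> word_edges ws \<Longrightarrow> heap_bd adj E (map_prod f f e) = f ` word_bd adj ws e"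
    by (rule word_heap_iso[OF iso], erule adj_sym, rule that)
  have fin: "finite (edges E)" "finite (elts E)"
    using f(2) bij_betw_finite[OF f(3)] by auto
  have ie: "inc_effective TYPE('k) (edges E) (heap_bd adj E)"
    by (rule inc_effective_image[where f = f and V = "{..<length ws}" and Ed = "word_edges ws"
          and B = "word_bd adj ws", OF f(3) word_bd_subset f(1) f(4) eff])
  have "(Poly_Mapping.single v 1 :: 'e \<Rightarrow>\<^sub>0 'k) \<in> boundary_map adj E ` C1 E"
    using assms(6) by (simp add: boundary_vertex_def)
  then obtain c :: "('e \<times> 'e) \<Rightarrow>\<^sub>0 'k" where c: "Poly_Mapping.keys c \<subseteq> edges E"
    "boundary_map adj E c = Poly_Mapping.single v 1"
    unfolding C1_def by (elim imageE) simp
  have "bsum (edges E) (heap_bd adj E) (Poly_Mapping.lookup c) x = of_bool (x = v)" for x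
    using lookup_boundary_map[OF fin c(1), of adj x] unfolding c(2) by (auto simp: lookup_single when_def)
  then have "inc_boundary TYPE('k) (edges E) (heap_bd adj E) v" unfolding inc_boundary_def by blast
  then obtain u e where u: "e \<in> edges E" "heap_bd adj E e = {u}" "(inc_rel (edges E) (heap_bd adj E))\<^sup>*\<^sup>* v u"
    using ie unfolding inc_effective_def by blast
  have bd_elts: "heap_bd adj E e \<subseteq> elts E" for e by (auto simp: heap_bd_def)
  have rel: "linear_relation TYPE('k) adj E x y" if r: "inc_rel (edges E) (heap_bd adj E) x y" for x y
  proof -
    obtain e where e: "x \<noteq> y" "e \<in> edges E" "heap_bd adj E e = {x, y}" using r by (auto simp: inc_rel_def)
    \<comment> \<open>\<open>x \<noteq> y\<close> makes the sum over \<open>{x, y}\<close> consist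
      of two terms.\<close>
    have "boundary_map adj E (Poly_Mapping.single e 1) = (Poly_Mapping.single x 1 + Poly_Mapping.single y 1 :: 'e \<Rightarrow>\<^sub>0 'k)"
      unfolding boundary_map_single boundary_edge_eq e(3) using e(1) by simp
    then show ?thesis unfolding linear_relation_def using e bd_elts[of e] by blast
  qed
  have "linearly_equivalent TYPE('k) adj E v u"
    unfolding linearly_equivalent_def using u(3)
    by (induction rule: rtranclp_induct) (auto intro: rtranclp.rtrancl_into_rtrancl rel)
  moreover have "effective_boundary_vertex TYPE('k) adj E u"
    unfolding effective_boundary_vertex_def
  proof (intro conjI bexI[OF _ u(1)])
    show "u \<in> elts E" using bd_elts[of e] u(2) by auto
    show "boundary_map adj E (Poly_Mapping.single e 1) = (Poly_Mapping.single u 1 :: 'e \<Rightarrow>\<^sub>0 'k)"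
      unfolding boundary_map_single boundary_edge_eq u(2) by simp
  qed
  ultimately show ?thesis by blast
qed

end
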